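(* Let $(A_n)_{n\in\mathbb{N}}$ be a sequence of complex square matrices with spectra in the open unit disc $\mathbb{D}$, and let $H_n=\mathrm{H}^2\ominus B_{A_n}\mathrm{H}^2$, $n\in\mathbb{N}$, be the associated model spaces. Then $(A_n)_{n\in\mathbb{N}}$ is strongly separated, i.e. \[ \inf_{z\in\mathbb{D}}\ \sup_{n\in\mathbb{N}}\ \prod_{k\neq n}|B_{A_k}(z)|>0, \] if and only if $(H_n)_{n\in\mathbb{N}}$ is strongly separated, i.e. \[ \inf_{n\in\mathbb{N}}\ \sin\Big(H_n,\ \overline{\mathrm{span}}_{j\neq n}\{H_j\}\Big)>0 . \]
   Context: $\mathrm{H}^2$ is the Hardy space of the unit disc $\mathbb{D}$. For $\tau\in\mathbb{D}$, $b_\tau(z)=\frac{\tau-z}{1-\overline{\tau}z}$. The order of an eigenvalue $\lambda$ of a square matrix $M$ is the maximal size of the Jordan blocks of $M$ associated with $\lambda$. If $M$ has distinct eigenvalues $\lambda_1,\dots,\lambda_k\in\mathbb{D}$ with orders $m_1,\dots,m_k$, then $B_M(z)=\prod_{j=1}^k b_{\lambda_j}(z)^{m_j}$. Infinite products of numbers in $[0,1]$ are limits of the (decreasing) partial products. For closed subspaces $L,K$ of a Hilbert space, $\sin(L,K):=\inf\{\mathrm{dist}(k,L)\mid k\in K,\ \|k\|=1\}$. *)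

theory Defs
  imports
    "HOL-Complex_Analysis.Complex_Analysis"
    "Jordan_Normal_Form.Spectral_Radius"
begin

section \<open>The Hardy space of the unit disc\<close>

definition taylor0 :: "(complex \<Rightarrow> complex) \<Rightarrow> nat \<Rightarrow> complex" where
  "taylor0 f n = (deriv ^^ n) f 0 / fact n"

text \<open>
  \<open>H\<^sup>2\<close> consists of the holomorphic functions on the open unit disc with square-summable
  Taylor coefficients. HOL functions are total, so the irrelevant values off the disc are
  normalised to 0; equality of elements is then equality on the disc.
\<close>

typedef hardy2 =
  "{f :: complex \<Rightarrow> complex. f holomorphic_on ball 0 1 \<and> (\<forall>z. z \<notin> ball 0 1 \<longrightarrow> f z = 0) \<and>
      summable (\<lambda>n. (norm (taylor0 f n))\<^sup>2)}"
  morphisms h2_fun Abs_hardy2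
proof -
  have "taylor0 (\<lambda>z. 0) = (\<lambda>n. 0)"
    by (auto simp: taylor0_def)
  then show ?thesis
    by (intro exI[of _ "\<lambda>z. 0"]) (simp add: holomorphic_on_const)
qed

setup_lifting type_definition_hardy2

lemma taylor0_lincomb:
  assumes "f holomorphic_on ball 0 1" "g holomorphic_on ball 0 1"
  shows "taylor0 (\<lambda>z. a * f z + b * g z) n = a * taylor0 f n + b * taylor0 g n"
proof -
  have "(deriv ^^ n) (\<lambda>z. a * f z + b * g z) 0
        = (deriv ^^ n) (\<lambda>z. a * f z) 0 + (deriv ^^ n) (\<lambda>z. b * g z) 0"
    by (rule higher_deriv_add[of _ "ball 0 1"]) (auto intro!: holomorphic_intros assms)
  also have "(deriv ^^ n) (\<lambda>z. a * f z) 0 = a * (deriv ^^ n) f 0"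
    by (rule higher_deriv_cmult[of _ "ball 0 1"]) (auto intro!: assms)
  also have "(deriv ^^ n) (\<lambda>z. b * g z) 0 = b * (deriv ^^ n) g 0"
    by (rule higher_deriv_cmult[of _ "ball 0 1"]) (auto intro!: assms)
  finally show ?thesis
    by (simp add: taylor0_def add_divide_distrib)
qed

lemma taylor0_scale:
  assumes "f holomorphic_on ball 0 1"
  shows "taylor0 (\<lambda>z. a * f z) n = a * taylor0 f n"
  using taylor0_lincomb[OF assms assms, of a 0] by simp

lemma taylor0_add:
  assumes "f holomorphic_on ball 0 1" "g holomorphic_on ball 0 1"
  shows "taylor0 (\<lambda>z. f z + g z) n = taylor0 f n + taylor0 g n"
  using taylor0_lincomb[OF assms, of 1 1] by simp

lemma summable_lincomb_sq:
  fixes a b :: "nat \<Rightarrow> complex"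
  assumes "summable (\<lambda>n. (norm (a n))\<^sup>2)" "summable (\<lambda>n. (norm (b n))\<^sup>2)"
  shows "summable (\<lambda>n. (norm (s * a n + t * b n))\<^sup>2)"
proof (rule summable_comparison_test')
  show "summable (\<lambda>n. 2 * (norm s)\<^sup>2 * (norm (a n))\<^sup>2 + 2 * (norm t)\<^sup>2 * (norm (b n))\<^sup>2)"
    using assms by (intro summable_add summable_mult)
  fix n :: nat
  have "(norm (s * a n + t * b n))\<^sup>2 \<le> (norm (s * a n) + norm (t * b n))\<^sup>2"
    by (intro power_mono norm_triangle_ineq) auto
  also have "\<dots> \<le> 2 * (norm (s * a n))\<^sup>2 + 2 * (norm (t * b n))\<^sup>2"
    using sum_squares_bound[of "norm (s * a n)" "norm (t * b n)"]
    by (simp add: power2_sum)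
  finally show "norm ((norm (s * a n + t * b n))\<^sup>2)
      \<le> 2 * (norm s)\<^sup>2 * (norm (a n))\<^sup>2 + 2 * (norm t)\<^sup>2 * (norm (b n))\<^sup>2"
    by (simp add: norm_mult power_mult_distrib)
qed

lemma hardy2_lincomb_aux:
  assumes "f holomorphic_on ball 0 1 \<and> (\<forall>z. z \<notin> ball 0 1 \<longrightarrow> f z = 0) \<and>
             summable (\<lambda>n. (norm (taylor0 f n))\<^sup>2)"
    and "g holomorphic_on ball 0 1 \<and> (\<forall>z. z \<notin> ball 0 1 \<longrightarrow> g z = 0) \<and>
             summable (\<lambda>n. (norm (taylor0 g n))\<^sup>2)"
  shows "(\<lambda>z. a * f z + b * g z) holomorphic_on ball 0 1 \<and>
         (\<forall>z. z \<notin> ball 0 1 \<longrightarrow> a * f z + b * g z = 0) \<and>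
         summable (\<lambda>n. (norm (taylor0 (\<lambda>z. a * f z + b * g z) n))\<^sup>2)"
  using assms by (auto simp: taylor0_lincomb intro!: holomorphic_intros summable_lincomb_sq)

instantiation hardy2 :: ab_group_add
begin

lift_definition zero_hardy2 :: hardy2 is "\<lambda>z. 0"
  by (simp add: taylor0_def)

lift_definition plus_hardy2 :: "hardy2 \<Rightarrow> hardy2 \<Rightarrow> hardy2" is "\<lambda>f g z. f z + g z"
  using hardy2_lincomb_aux[of _ _ 1 1] by simp

lift_definition uminus_hardy2 :: "hardy2 \<Rightarrow> hardy2" is "\<lambda>f z. - f z"
  subgoal for f using hardy2_lincomb_aux[of f f "-1" 0] by simp
  done

lift_definition minus_hardy2 :: "hardy2 \<Rightarrow> hardy2 \<Rightarrow> hardy2" is "\<lambda>f g z. f z - g z"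
  using hardy2_lincomb_aux[of _ _ 1 "-1"] by simp

instance
  by standard (transfer; simp add: fun_eq_iff)+

end

lift_definition scaleC_h2 :: "complex \<Rightarrow> hardy2 \<Rightarrow> hardy2" is "\<lambda>c f z. c * f z"
  subgoal for c f using hardy2_lincomb_aux[of f f c 0] by simp
  done

global_interpretation h2: vector_space scaleC_h2
  by standard (transfer; simp add: fun_eq_iff algebra_simps)+

lift_definition h2_coeff :: "hardy2 \<Rightarrow> nat \<Rightarrow> complex" is taylor0 .

definition cinner_h2 :: "hardy2 \<Rightarrow> hardy2 \<Rightarrow> complex" where
  "cinner_h2 f g = (\<Sum>n. h2_coeff f n * cnj (h2_coeff g n))"

lemma h2_coeff_add: "h2_coeff (f + g) n = h2_coeff f n + h2_coeff g n"
  by transfer (simp add: taylor0_add)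

lemma h2_coeff_scaleC: "h2_coeff (scaleC_h2 c f) n = c * h2_coeff f n"
  by transfer (simp add: taylor0_scale)

lemma h2_coeff_zero: "h2_coeff 0 n = 0"
  by transfer (simp add: taylor0_def)

lemma h2_coeff_sq_summable: "summable (\<lambda>n. (norm (h2_coeff f n))\<^sup>2)"
  by transfer simp

lemma h2_eqI:
  assumes "\<And>n. h2_coeff f n = h2_coeff g n"
  shows "f = g"
  using assms
proof transfer
  fix f g :: "complex \<Rightarrow> complex"
  assume f: "f holomorphic_on ball 0 1 \<and> (\<forall>z. z \<notin> ball 0 1 \<longrightarrow> f z = 0) \<and>
             summable (\<lambda>n. (norm (taylor0 f n))\<^sup>2)"
    and g: "g holomorphic_on ball 0 1 \<and> (\<forall>z. z \<notin> ball 0 1 \<longrightarrow> g z = 0) \<and>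
             summable (\<lambda>n. (norm (taylor0 g n))\<^sup>2)"
    and eq: "\<And>n. taylor0 f n = taylor0 g n"
  have "f z = g z" for z
  proof (cases "z \<in> ball 0 1")
    case True
    show ?thesis
      by (rule holomorphic_fun_eq_on_ball[of f 0 1 g])
         (use f g eq True in \<open>auto simp: taylor0_def\<close>)
  qed (use f g in auto)
  then show "f = g" by blast
qed

lemma summable_cinner_h2: "summable (\<lambda>n. h2_coeff f n * cnj (h2_coeff g n))"
proof (rule summable_comparison_test')
  show "summable (\<lambda>n. (norm (h2_coeff f n))\<^sup>2 + (norm (h2_coeff g n))\<^sup>2)"
    by (intro summable_add h2_coeff_sq_summable)
  fix n :: nat
  have "2 * (norm (h2_coeff f n) * norm (h2_coeff g n))
        \<le> (norm (h2_coeff f n))\<^sup>2 + (norm (h2_coeff g n))\<^sup>2"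
    using sum_squares_bound[of "norm (h2_coeff f n)" "norm (h2_coeff g n)"] by simp
  moreover have "0 \<le> norm (h2_coeff f n) * norm (h2_coeff g n)" by simp
  ultimately show "norm (h2_coeff f n * cnj (h2_coeff g n))
      \<le> (norm (h2_coeff f n))\<^sup>2 + (norm (h2_coeff g n))\<^sup>2"
    unfolding norm_mult complex_mod_cnj by linarith
qed

lemma cinner_h2_add_left: "cinner_h2 (f + g) h = cinner_h2 f h + cinner_h2 g h"
  unfolding cinner_h2_def
  by (subst suminf_add) (simp_all add: summable_cinner_h2 h2_coeff_add algebra_simps)

lemma cinner_h2_scaleC_left: "cinner_h2 (scaleC_h2 c f) g = c * cinner_h2 f g"
  unfolding cinner_h2_def
  by (subst suminf_mult[symmetric]) (simp_all add: summable_cinner_h2 h2_coeff_scaleC algebra_simps)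

lemma cinner_h2_commute: "cinner_h2 f g = cnj (cinner_h2 g f)"
proof -
  have "(\<lambda>n. cnj (h2_coeff g n * cnj (h2_coeff f n))) sums cnj (cinner_h2 g f)"
    unfolding cinner_h2_def sums_cnj by (rule summable_sums[OF summable_cinner_h2])
  then show ?thesis
    unfolding cinner_h2_def[of f g] by (simp add: sums_iff mult.commute)
qed

lemma cinner_h2_self: "cinner_h2 f f = of_real (\<Sum>n. (norm (h2_coeff f n))\<^sup>2)"
proof -
  have "(\<lambda>n. complex_of_real ((norm (h2_coeff f n))\<^sup>2))
          sums of_real (\<Sum>n. (norm (h2_coeff f n))\<^sup>2)"
    by (intro sums_of_real summable_sums h2_coeff_sq_summable)
  then show ?thesis
    unfolding cinner_h2_def complex_norm_square by (simp add: sums_iff)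
qed

instantiation hardy2 :: real_vector
begin

definition scaleR_hardy2 :: "real \<Rightarrow> hardy2 \<Rightarrow> hardy2" where
  "scaleR_hardy2 r f = scaleC_h2 (of_real r) f"

instance
proof
  fix f g :: hardy2 and r s :: real
  show "r *\<^sub>R (f + g) = r *\<^sub>R f + r *\<^sub>R g"
    by (simp add: scaleR_hardy2_def h2.scale_right_distrib)
  show "(r + s) *\<^sub>R f = r *\<^sub>R f + s *\<^sub>R f"
    by (simp add: scaleR_hardy2_def h2.scale_left_distrib)
  show "r *\<^sub>R s *\<^sub>R f = (r * s) *\<^sub>R f"
    by (simp add: scaleR_hardy2_def)
  show "1 *\<^sub>R f = f"
    by (simp add: scaleR_hardy2_def)
qed

end

text \<open>
  The library has no complex inner product spaces. The real inner product below is the real part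
  of the Hermitian one and induces the same norm; orthogonality and spans are taken
  over the complex numbers further down.
\<close>

instantiation hardy2 :: real_inner
begin

definition inner_hardy2 :: "hardy2 \<Rightarrow> hardy2 \<Rightarrow> real" where
  "inner_hardy2 f g = Re (cinner_h2 f g)"

definition norm_hardy2 :: "hardy2 \<Rightarrow> real" where
  "norm_hardy2 f = sqrt (inner f f)"

definition sgn_hardy2 :: "hardy2 \<Rightarrow> hardy2" where
  "sgn_hardy2 f = f /\<^sub>R norm f"

definition dist_hardy2 :: "hardy2 \<Rightarrow> hardy2 \<Rightarrow> real" where
  "dist_hardy2 f g = norm (f - g)"

definition uniformity_hardy2 :: "(hardy2 \<times> hardy2) filter" where
  "uniformity_hardy2 = (INF e\<in>{0<..}. principal {(x, y). dist x y < e})"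

definition open_hardy2 :: "hardy2 set \<Rightarrow> bool" where
  "open_hardy2 U \<longleftrightarrow> (\<forall>x\<in>U. \<forall>\<^sub>F (x', y) in uniformity. x' = x \<longrightarrow> y \<in> U)"

instance
proof
  fix f g h :: hardy2 and r :: real
  show "inner f g = inner g f"
    using cinner_h2_commute[of f g] by (simp add: inner_hardy2_def)
  show "inner (f + g) h = inner f h + inner g h"
    by (simp add: inner_hardy2_def cinner_h2_add_left)
  show "inner (r *\<^sub>R f) g = r * inner f g"
    by (simp add: inner_hardy2_def scaleR_hardy2_def cinner_h2_scaleC_left)
  show "0 \<le> inner f f"
    by (simp add: inner_hardy2_def cinner_h2_self suminf_nonneg h2_coeff_sq_summable)
  show "inner f f = 0 \<longleftrightarrow> f = 0"
  proof
    assume "inner f f = 0"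
    then have "(\<Sum>n. (norm (h2_coeff f n))\<^sup>2) = 0"
      by (simp add: inner_hardy2_def cinner_h2_self)
    then have "\<And>n. h2_coeff f n = 0"
      by (subst (asm) suminf_eq_zero_iff) (auto simp: h2_coeff_sq_summable)
    then show "f = 0"
      by (intro h2_eqI) (simp add: h2_coeff_zero)
  next
    assume "f = 0"
    then show "inner f f = 0"
      by (simp add: inner_hardy2_def cinner_h2_self h2_coeff_zero)
  qed
qed (simp_all add: norm_hardy2_def sgn_hardy2_def dist_hardy2_def uniformity_hardy2_def
       open_hardy2_def)

end

section \<open>Blaschke products of matrices and model spaces\<close>

definition blaschke_factor :: "complex \<Rightarrow> complex \<Rightarrow> complex" where
  "blaschke_factor \<tau> z = (\<tau> - z) / (1 - cnj \<tau> * z)"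

text \<open>
  The Jordan normal form is unique up to the order of its blocks, so quantifying over all
  of them yields the block sizes of any one.
\<close>

definition eigenvalue_order :: "complex mat \<Rightarrow> complex \<Rightarrow> nat" where
  "eigenvalue_order M \<mu> = Max {m. \<exists>n_as. jordan_nf M n_as \<and> (m, \<mu>) \<in> set n_as}"

definition blaschke_mat :: "complex mat \<Rightarrow> complex \<Rightarrow> complex" where
  "blaschke_mat M z = (\<Prod>\<mu>\<in>spectrum M. blaschke_factor \<mu> z ^ eigenvalue_order M \<mu>)"

text \<open>\<open>B H\<^sup>2\<close>, for a function \<open>B\<close> bounded and holomorphic on the disc.\<close>

definition mult_h2 :: "(complex \<Rightarrow> complex) \<Rightarrow> hardy2 set" where
  "mult_h2 B = {f. \<exists>g. \<forall>z\<in>ball 0 1. h2_fun f z = B z * h2_fun g z}"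

definition model_space :: "(complex \<Rightarrow> complex) \<Rightarrow> hardy2 set" where
  "model_space B = {f. \<forall>g\<in>mult_h2 B. cinner_h2 f g = 0}"

section \<open>Separation\<close>

text \<open>
  For factors in \<open>[0, 1]\<close> the partial products decrease, so the limit exists. The library's
  \<^const>\<open>prodinf\<close> is not used because it leaves products that diverge to 0 unspecified.
\<close>

definition prod_except :: "nat \<Rightarrow> (nat \<Rightarrow> real) \<Rightarrow> real" where
  "prod_except n a = lim (\<lambda>N. \<Prod>k\<in>{..<N} - {n}. a k)"

definition subspace_sin :: "'a::real_normed_vector set \<Rightarrow> 'a set \<Rightarrow> real" where
  "subspace_sin L K = (INF k\<in>{k \<in> K. norm k = 1}. infdist k L)"

definition closed_span_h2 :: "hardy2 set \<Rightarrow> hardy2 set" where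
  "closed_span_h2 S = closure (h2.span S)"

end

theory Submission
  imports Defs
begin

text \<open>
  Write \<open>B\<^sub>n\<close> for the Blaschke product of \<open>A\<^sub>n\<close> and \<open>C\<close> for a finite product of the \<open>B\<^sub>k\<close>, \<open>k \<noteq> n\<close>.
  Both separation conditions turn out to be equivalent to a uniform lower bound
  \<open>max \<bar>B\<^sub>n(z)\<bar> \<bar>C(z)\<bar> \<ge> \<epsilon>\<close> on the disc.

  If the spaces are strongly separated, no zero is shared, so by partial fractions the span of the
  other spaces contains the model space of \<open>C\<close>. Comparing the projections of a reproducing kernel
  at \<open>z\<close> onto the model spaces of \<open>B\<^sub>n\<close> and \<open>C\<close> gives the lower bound at \<open>z\<close>. Where some
  \<open>\<bar>B\<^sub>n\<bar>\<close> is at most \<open>\<epsilon>\<close> the product of the others is then at least \<open>\<epsilon>\<close>; on the rest of the disc the maximum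
  principle for the reciprocal of the full product, whose modulus is at most \<open>1 / \<epsilon>\<^sup>2\<close> on the
  boundary of that region, yields \<open>\<epsilon>\<^sup>2\<close>.

  Conversely, let \<open>x\<close> and \<open>h\<close> be in the model spaces of \<open>C\<close> and \<open>B = B\<^sub>n\<close>, and \<open>y = x - h\<close>. On the circle
  \<open>w = C cnj x\<close> and \<open>t = B cnj h\<close> are boundary values of holomorphic functions vanishing at 0, so
  \<open>\<bar>x\<bar>\<^sup>2\<close> is, up to \<open>x cnj y / 2\<close>, the boundary value of \<open>F = x (cnj B t + cnj C w) / D\<close> with
  \<open>D = \<bar>B\<bar>\<^sup>2 + \<bar>C\<bar>\<^sup>2\<close>. As in Wolff's proof of the corona theorem,
  \<open>F\<close> satisfies a d-bar equation whose right-hand side involves \<open>x\<close> and the holomorphic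
  function \<open>q = B w - C t\<close>, which has modulus \<open>\<bar>y\<bar>\<close> on the circle. Its Laplacian is dominated by that of a sum of squared
  moduli of holomorphic functions, and the sub-mean value property bounds \<open>norm x\<close> by
  a multiple of \<open>norm y\<close>, with no area integrals.
\<close>

section \<open>Wirtinger derivatives and subharmonic functions\<close>

text \<open>\<open>a\<close> and \<open>b\<close> are the Wirtinger derivatives of \<open>F\<close>
  with respect to \<open>z\<close> and \<open>cnj z\<close>: the real differential written in
  complex form.\<close>

definition has_wirtinger :: "(complex \<Rightarrow> complex) \<Rightarrow> complex \<Rightarrow> complex \<Rightarrow> complex \<Rightarrow> bool" where
  "has_wirtinger F a b z \<longleftrightarrow> (F has_derivative (\<lambda>h. a * h + b * cnj h)) (at z)"

lemma has_wirtinger_holomorphic: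
  assumes "f holomorphic_on S" "open S" "z \<in> S"
  shows "has_wirtinger f (deriv f z) 0 z"
  using holomorphic_derivI[OF assms]
  by (simp add: has_wirtinger_def has_field_derivative_def mult_commute_abs)

lemma has_wirtinger_cnj:
  assumes "has_wirtinger F a b z"
  shows "has_wirtinger (\<lambda>w. cnj (F w)) (cnj b) (cnj a) z"
  using has_derivative_cnj[OF assms[unfolded has_wirtinger_def]]
  by (simp add: has_wirtinger_def add.commute)

lemma has_wirtinger_add:
  assumes "has_wirtinger F a b z" "has_wirtinger G a' b' z"
  shows "has_wirtinger (\<lambda>w. F w + G w) (a + a') (b + b') z"
  using has_derivative_add[OF assms[unfolded has_wirtinger_def]]
  by (simp add: has_wirtinger_def algebra_simps)

lemma has_wirtinger_mult:
  assumes "has_wirtinger F a b z" "has_wirtinger G a' b' z"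
  shows "has_wirtinger (\<lambda>w. F w * G w) (a * G z + F z * a') (b * G z + F z * b') z"
  using has_derivative_mult[OF assms[unfolded has_wirtinger_def]]
  by (simp add: has_wirtinger_def algebra_simps)

lemma has_wirtinger_inverse:
  assumes "has_wirtinger F a b z" "F z \<noteq> 0"
  shows "has_wirtinger (\<lambda>w. inverse (F w)) (- a / (F z)\<^sup>2) (- b / (F z)\<^sup>2) z"
  unfolding has_wirtinger_def
  by (rule has_derivative_eq_rhs[OF Deriv.has_derivative_inverse[OF assms(2) assms(1)[unfolded has_wirtinger_def]]])
    (use assms(2) in \<open>auto simp: power2_eq_square field_simps\<close>)

lemma circle_mean_has_derivative:
  fixes F a b :: "complex \<Rightarrow> complex"
  assumes cont: "continuous_on (ball 0 1) a" "continuous_on (ball 0 1) b"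
    and F: "\<And>z. z \<in> ball 0 1 \<Longrightarrow> has_wirtinger F (a z) (b z) z"
    and r: "r \<in> {-1<..<1}"
  defines "M \<equiv> \<lambda>G r. integral {0..2*pi} (\<lambda>s. G (of_real r * cis s))"
  obtains D where "((\<lambda>r. M F r) has_vector_derivative D) (at r)"
    "of_real r * D = 2 * M (\<lambda>z. z * a z) r" "of_real r * D = 2 * M (\<lambda>z. cnj z * b z) r"
proof -
  define U where "U = {-1<..<1::real}"
  define D where "D = integral {0..2*pi} (\<lambda>s. a (of_real r * cis s) * cis s + b (of_real r * cis s) * cnj (cis s))"
  have inb: "complex_of_real r * cis s \<in> ball 0 1" if "r \<in> U" for r s
    using that by (auto simp: U_def norm_mult)
  have rU: "r \<in> U" using r by (simp add: U_def)
  have der: "((\<lambda>r. F (of_real r * cis s)) has_vector_derivative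
      (a (of_real r * cis s) * cis s + b (of_real r * cis s) * cnj (cis s))) (at r within U)" if "r \<in> U" for r s
  proof -
    have "((\<lambda>r. complex_of_real r * cis s) has_derivative (\<lambda>h. of_real h * cis s)) (at r within U)"
      by (auto intro!: derivative_eq_intros)
    from has_derivative_compose[OF this F[OF inb[OF that], unfolded has_wirtinger_def]]
    show ?thesis
      unfolding has_vector_derivative_def
      by (rule has_derivative_eq_rhs) (auto simp: scaleR_conv_of_real algebra_simps)
  qed
  have ders: "((\<lambda>s. F (of_real r * cis s)) has_vector_derivative
      (\<i> * of_real r * (a (of_real r * cis s) * cis s - b (of_real r * cis s) * cnj (cis s)))) (at s within {0..2*pi})"
    for s
  proof -
    have "((\<lambda>s. complex_of_real r * cis s) has_derivative (\<lambda>h. of_real r * (of_real h * (\<i> * cis s)))) (at s within {0..2*pi})"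
      by (auto intro!: derivative_eq_intros simp: scaleR_conv_of_real algebra_simps)
    from has_derivative_compose[OF this F[OF inb[OF rU], unfolded has_wirtinger_def]]
    show ?thesis
      unfolding has_vector_derivative_def
      by (rule has_derivative_eq_rhs) (auto simp: scaleR_conv_of_real algebra_simps)
  qed
  have contF: "continuous_on (ball 0 1) F"
    by (intro continuous_at_imp_continuous_on ballI has_derivative_continuous[OF F[unfolded has_wirtinger_def]])
  have contr: "continuous_on {0..2*pi} (\<lambda>s. G (of_real r * cis s))" if "continuous_on (ball 0 1) G" "r \<in> U"
    for G :: "complex \<Rightarrow> complex" and r
    by (rule continuous_on_compose2[OF that(1)]) (auto intro!: continuous_intros inb[OF that(2), simplified])
  have cont2: "continuous_on (U \<times> {0..2*pi}) (\<lambda>p. G (of_real (fst p) * cis (snd p)))"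
    if "continuous_on (ball 0 1) G" for G :: "complex \<Rightarrow> complex"
    by (rule continuous_on_compose2[OF that]) (auto intro!: continuous_intros inb[simplified])
  note contra = contr[OF cont(1) rU] and contrb = contr[OF cont(2) rU]
  have "((\<lambda>r. integral (cbox 0 (2*pi)) (\<lambda>s. F (of_real r * cis s))) has_vector_derivative
      integral (cbox 0 (2*pi)) (\<lambda>s. a (of_real r * cis s) * cis s + b (of_real r * cis s) * cnj (cis s))) (at r within U)"
    apply (rule leibniz_rule_vector_derivative[OF der])
    subgoal by simp
    subgoal by (simp add: integrable_continuous_real contr[OF contF])
    subgoal by (unfold split_beta cbox_interval, intro continuous_intros cont2[OF cont(1)] cont2[OF cont(2)])
    using r by (auto simp: U_def)
  then have "((\<lambda>r. M F r) has_vector_derivative D) (at r)"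
    using r at_within_open[of r U] by (simp add: M_def D_def U_def)
  moreover
  have eq0: "integral {0..2*pi} (\<lambda>s. \<i> * of_real r * (a (of_real r * cis s) * cis s - b (of_real r * cis s) * cnj (cis s))) = 0"
    using fundamental_theorem_of_calculus[OF _ ders, simplified]
    by (simp add: has_integral_iff)
  have eq1: "integral {0..2*pi} (\<lambda>s. \<i> * of_real r * (a (of_real r * cis s) * cis s - b (of_real r * cis s) * cnj (cis s)))
     = \<i> * (M (\<lambda>z. z * a z) r - M (\<lambda>z. cnj z * b z) r)"
    unfolding M_def
    apply (subst integral_diff[symmetric])
    subgoal by (intro integrable_continuous_real continuous_intros contra contrb)
    subgoal by (intro integrable_continuous_real continuous_intros contra contrb)
    apply (subst integral_mult_right[symmetric])
    apply (rule integral_cong)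
    by (simp add: algebra_simps)
  have e: "M (\<lambda>z. z * a z) r = M (\<lambda>z. cnj z * b z) r"
    using trans[OF eq1[symmetric] eq0] by simp
  have "of_real r * D = M (\<lambda>z. z * a z) r + M (\<lambda>z. cnj z * b z) r"
    unfolding M_def D_def
    apply (subst integral_add[symmetric])
    subgoal by (intro integrable_continuous_real continuous_intros contra contrb)
    subgoal by (intro integrable_continuous_real continuous_intros contra contrb)
    apply (subst integral_mult_right[symmetric])
    apply (rule integral_cong)
    by (simp add: algebra_simps)
  ultimately show ?thesis using that[of D] e by simp
qed


text \<open>\<open>c\<close> is a quarter of the Laplacian of \<open>F\<close>.\<close>

definition has_ddbar :: "(complex \<Rightarrow> complex) \<Rightarrow> (complex \<Rightarrow> complex) \<Rightarrow> bool" where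
  "has_ddbar F c \<longleftrightarrow> (\<exists>a b d. continuous_on (ball 0 1) a \<and> continuous_on (ball 0 1) c \<and>
     continuous_on (ball 0 1) d \<and>
     (\<forall>z\<in>ball 0 1. has_wirtinger F (a z) (b z) z \<and> has_wirtinger b (c z) (d z) z))"

lemma has_wirtinger_isCont: "has_wirtinger F a b z \<Longrightarrow> isCont F z"
  unfolding has_wirtinger_def by (rule has_derivative_continuous)

text \<open>The mean derivative is used twice. With \<open>V z = cnj z * b z\<close>, the mean of
  \<open>F\<close> has radial derivative \<open>2 * M V r / r\<close>, and that of \<open>V\<close>
  has \<open>2 * r * M c r\<close>. So \<open>Re (M V r)\<close> grows from 0 and is nonnegative,
  hence \<open>Re (M F r)\<close> grows too; continuity on the closed disc carries this to radius
  1.\<close>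

lemma subharmonic_circle_mean:
  assumes F: "has_ddbar F c" and c: "\<And>z. z \<in> ball 0 1 \<Longrightarrow> Re (c z) \<ge> 0"
    and contF: "continuous_on (cball 0 1) F"
  shows "2 * pi * Re (F 0) \<le> Re (integral {0..2*pi} (\<lambda>s. F (cis s)))"
proof -
  obtain a b d where conta: "continuous_on (ball 0 1) a" and contc: "continuous_on (ball 0 1) c"
    and contd: "continuous_on (ball 0 1) d"
    and wF: "\<And>z. z\<in>ball 0 1 \<Longrightarrow> has_wirtinger F (a z) (b z) z"
    and wb: "\<And>z. z\<in>ball 0 1 \<Longrightarrow> has_wirtinger b (c z) (d z) z"
    using F unfolding has_ddbar_def by blast
  have contb: "continuous_on (ball 0 1) b"
    by (intro continuous_at_imp_continuous_on ballI has_wirtinger_isCont[OF wb])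
  define M where "M = (\<lambda>G r. integral {0..2*pi} (\<lambda>s. G (complex_of_real r * cis s)) :: complex)"
  define V where "V = (\<lambda>z. cnj z * b z)"
  have wV: "has_wirtinger V (cnj z * c z) (b z + cnj z * d z) z" if "z \<in> ball 0 1" for z
  proof -
    have "has_wirtinger cnj 0 1 z"
      unfolding has_wirtinger_def by (simp add: bounded_linear_cnj bounded_linear_imp_has_derivative)
    from has_wirtinger_mult[OF this wb[OF that]] show ?thesis by (simp add: V_def)
  qed
  have *: "\<exists>D. ((\<lambda>r. M V r) has_vector_derivative D) (at r) \<and> of_real r * D = 2 * of_real r ^ 2 * M c r"
    if r: "r \<in> {-1<..<1}" for r
  proof -
    obtain D where "((\<lambda>r. M V r) has_vector_derivative D) (at r)"
      "of_real r * D = 2 * M (\<lambda>z. z * (cnj z * c z)) r"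
      unfolding M_def
      by (rule circle_mean_has_derivative[OF _ _ wV r]) (auto intro!: continuous_intros contc contd contb)
    moreover have "M (\<lambda>z. z * (cnj z * c z)) r = of_real r ^ 2 * M c r"
    proof -
      have "of_real r * cis s * (cnj (of_real r * cis s) * w) = of_real r ^ 2 * w" for s w
        using complex_norm_square[of "cis s"] by (simp add: power2_eq_square algebra_simps)
      then show ?thesis unfolding M_def by (simp only: integral_mult_right)
    qed
    ultimately show ?thesis by auto
  qed
  have **: "\<exists>D. ((\<lambda>r. M F r) has_vector_derivative D) (at r) \<and> of_real r * D = 2 * M V r"
    if r: "r \<in> {-1<..<1}" for r
    unfolding M_def V_def
    by (rule circle_mean_has_derivative[OF conta contb wF r]) auto
  have derRe: "((\<lambda>r. Re (f r)) has_real_derivative Re D) (at r)"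
    if "(f has_vector_derivative D) (at r)" for f D and r :: real
    using bounded_linear.has_vector_derivative[OF bounded_linear_Re that]
    by (simp add: has_real_derivative_iff_has_vector_derivative)
  have Mc: "Re (M c r) \<ge> 0" if r: "r \<in> {-1<..<1}" for r
  proof -
    have inb: "complex_of_real r * cis s \<in> ball 0 1" for s
      using that by (auto simp: norm_mult)
    have "continuous_on {0..2*pi} (\<lambda>s. c (of_real r * cis s))"
      by (rule continuous_on_compose2[OF contc]) (auto intro!: continuous_intros inb[simplified])
    then have i: "(\<lambda>s. c (of_real r * cis s)) integrable_on {0..2*pi}"
      by (rule integrable_continuous_real)
    have "Re (M c r) = integral {0..2*pi} (\<lambda>s. Re (c (of_real r * cis s)))"
      unfolding M_def using integral_linear[OF i bounded_linear_Re] by (simp add: o_def)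
    also have "\<dots> \<ge> 0"
      by (intro integral_nonneg integrable_linear[OF i bounded_linear_Re, unfolded o_def]) (auto intro!: c inb simp del: mem_ball)
    finally show ?thesis .
  qed
  have N: "Re (M V r) \<ge> 0" if r: "r \<in> {0<..<1}" for r
  proof -
    have "Re (M V 0) \<le> Re (M V r)"
    proof (rule DERIV_nonneg_imp_increasing_open[where f = "\<lambda>r. Re (M V r)"])
      show "0 \<le> r" using r by simp
      show "continuous_on {0..r} (\<lambda>r. Re (M V r))"
      proof (intro continuous_at_imp_continuous_on ballI)
        fix s assume "s \<in> {0..r}"
        then have "s \<in> {-1<..<1}" using r by auto
        from *[OF this] show "isCont (\<lambda>r. Re (M V r)) s"
          by (auto dest!: derRe DERIV_isCont)
      qed
      fix s assume s: "0 < s" "s < r"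
      then have s': "s \<in> {-1<..<1}" using r by auto
      from *[OF s'] obtain D where D: "((\<lambda>r. M V r) has_vector_derivative D) (at s)"
        "of_real s * D = 2 * of_real s ^ 2 * M c s" by auto
      have "D = of_real (2 * s) * M c s" using D(2) s by (simp add: power2_eq_square)
      then have "Re D \<ge> 0" using Mc[OF s'] s by simp
      with derRe[OF D(1)] show "\<exists>y. ((\<lambda>r. Re (M V r)) has_real_derivative y) (at s) \<and> 0 \<le> y"
        by auto
    qed
    moreover have "M V 0 = 0" by (simp add: M_def V_def)
    ultimately show ?thesis by simp
  qed
  have "Re (M F 0) \<le> Re (M F 1)"
  proof (rule DERIV_nonneg_imp_increasing_open[where f = "\<lambda>r. Re (M F r)"])
    have "continuous_on {0..1} (\<lambda>r. M F r)"
      unfolding M_def cbox_interval[symmetric]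
      by (rule integral_continuous_on_param)
        (auto simp: split_beta norm_mult intro!: continuous_intros continuous_on_compose2[OF contF])
    then show "continuous_on {0..1} (\<lambda>r. Re (M F r))" by (intro continuous_intros)
    fix s :: real assume s: "0 < s" "s < 1"
    then obtain D where D: "((\<lambda>r. M F r) has_vector_derivative D) (at s)"
        "of_real s * D = 2 * M V s" using **[of s] by auto
    have "D = of_real (2 / s) * M V s" using D(2) s by (simp add: field_simps)
    then have "Re D \<ge> 0" using N[of s] s by simp
    with derRe[OF D(1)] show "\<exists>y. ((\<lambda>r. Re (M F r)) has_real_derivative y) (at s) \<and> 0 \<le> y"
      by auto
  qed simp
  then show ?thesis by (simp add: M_def scaleR_conv_of_real)
qed

section \<open>Rules for mixed second derivatives\<close>

lemma has_ddbar_add: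
  assumes "has_ddbar F c" "has_ddbar G e"
  shows "has_ddbar (\<lambda>z. F z + G z) (\<lambda>z. c z + e z)"
proof -
  obtain a b d a' b' d' where "continuous_on (ball 0 1) a" "continuous_on (ball 0 1) c"
     "continuous_on (ball 0 1) d" "continuous_on (ball 0 1) a'" "continuous_on (ball 0 1) e"
     "continuous_on (ball 0 1) d'"
     "\<forall>z\<in>ball 0 1. has_wirtinger F (a z) (b z) z \<and> has_wirtinger b (c z) (d z) z"
     "\<forall>z\<in>ball 0 1. has_wirtinger G (a' z) (b' z) z \<and> has_wirtinger b' (e z) (d' z) z"
    using assms unfolding has_ddbar_def by metis
  then show ?thesis
    unfolding has_ddbar_def
    by (intro exI[of _ "\<lambda>z. a z + a' z"] exI[of _ "\<lambda>z. b z + b' z"] exI[of _ "\<lambda>z. d z + d' z"]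
        conjI ballI continuous_intros has_wirtinger_add) auto
qed

lemma has_wirtinger_cmult: "has_wirtinger F a b z \<Longrightarrow> has_wirtinger (\<lambda>w. k * F w) (k * a) (k * b) z"
  using has_wirtinger_mult[of "\<lambda>_. k" 0 0 z F a b] by (simp add: has_wirtinger_def)

lemma has_ddbar_cmult:
  assumes "has_ddbar F c"
  shows "has_ddbar (\<lambda>z. k * F z) (\<lambda>z. k * c z)"
proof -
  obtain a b d where "continuous_on (ball 0 1) a" "continuous_on (ball 0 1) c"
     "continuous_on (ball 0 1) d"
     "\<forall>z\<in>ball 0 1. has_wirtinger F (a z) (b z) z \<and> has_wirtinger b (c z) (d z) z"
    using assms unfolding has_ddbar_def by metis
  then show ?thesis
    unfolding has_ddbar_def
    by (intro exI[of _ "\<lambda>z. k * a z"] exI[of _ "\<lambda>z. k * b z"] exI[of _ "\<lambda>z. k * d z"]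
        conjI ballI continuous_intros has_wirtinger_cmult) auto
qed

text \<open>Squared moduli of holomorphic functions supply the positive Laplacians that later
  dominate the corona term.\<close>

lemma has_ddbar_holomorphic_mult_cnj:
  assumes "f holomorphic_on ball 0 1"
  shows "has_ddbar (\<lambda>z. f z * cnj (f z)) (\<lambda>z. deriv f z * cnj (deriv f z))"
proof -
  have d: "deriv f holomorphic_on ball 0 1" "deriv (deriv f) holomorphic_on ball 0 1"
    by (auto intro!: holomorphic_deriv assms)
  have c: "continuous_on (ball 0 1) f" "continuous_on (ball 0 1) (deriv f)"
    "continuous_on (ball 0 1) (deriv (deriv f))"
    using assms d by (auto intro: holomorphic_on_imp_continuous_on)
  have w: "has_wirtinger f (deriv f z) 0 z" "has_wirtinger (\<lambda>z. cnj (f z)) 0 (cnj (deriv f z)) z"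
     "has_wirtinger (\<lambda>z. cnj (deriv f z)) 0 (cnj (deriv (deriv f) z)) z" if "z \<in> ball 0 1" for z
    using has_wirtinger_holomorphic[OF assms _ that] has_wirtinger_holomorphic[OF d(1) _ that]
      has_wirtinger_cnj by force+
  show ?thesis
    unfolding has_ddbar_def
    apply (rule exI[of _ "\<lambda>z. deriv f z * cnj (f z)"], rule exI[of _ "\<lambda>z. f z * cnj (deriv f z)"],
      rule exI[of _ "\<lambda>z. f z * cnj (deriv (deriv f) z)"])
    apply (intro conjI ballI continuous_intros c)
    subgoal for z using has_wirtinger_mult[OF w(1,2), of z] by simp
    subgoal for z using has_wirtinger_mult[OF w(1,3), of z] by simp
    done
qed

section \<open>The corona estimate on the circle\<close>

lemma has_wirtinger_eq_rhs:
  "has_wirtinger F a b z \<Longrightarrow> a = a' \<Longrightarrow> b = b' \<Longrightarrow> has_wirtinger F a' b' z"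
  by simp

text \<open>The numerator produced by the quotient rule factors, so the d-bar derivative of the
  function is \<open>x * q * cnj W / D^2\<close>. As \<open>x\<close> and \<open>q\<close> are
  holomorphic and \<open>cnj W\<close> is antiholomorphic, the remaining derivative in
  \<open>z\<close> falls only on \<open>x * q\<close> and on \<open>D\<close>.\<close>

lemma has_ddbar_corona:
  fixes B C x t w :: "complex \<Rightarrow> complex"
  assumes hol: "B holomorphic_on ball 0 1" "C holomorphic_on ball 0 1" "x holomorphic_on ball 0 1"
      "t holomorphic_on ball 0 1" "w holomorphic_on ball 0 1"
    and nz: "\<And>z. z \<in> ball 0 1 \<Longrightarrow> B z * cnj (B z) + C z * cnj (C z) \<noteq> 0"
  defines "D \<equiv> \<lambda>z. B z * cnj (B z) + C z * cnj (C z)"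
    and "q \<equiv> \<lambda>z. B z * w z - C z * t z"
    and "W \<equiv> \<lambda>z. B z * deriv C z - C z * deriv B z"
  shows "has_ddbar (\<lambda>z. x z * (cnj (B z) * t z + cnj (C z) * w z) * inverse (D z))
    (\<lambda>z. cnj (W z) * ((deriv x z * q z + x z * deriv q z) * (inverse (D z))\<^sup>2
      - 2 * x z * q z * (deriv B z * cnj (B z) + deriv C z * cnj (C z)) * (inverse (D z))^3))"
proof -
  let ?S = "ball 0 1 :: complex set"
  have d: "deriv f holomorphic_on ?S" if "f holomorphic_on ?S" for f
    using that by (intro holomorphic_deriv) auto
  have holq: "q holomorphic_on ?S" and holW: "W holomorphic_on ?S"
    unfolding q_def W_def by (intro holomorphic_intros hol d)+
  note hol' = hol holq holW
  note hol'' = hol' hol'[THEN d] hol'[THEN d, THEN d]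
  note c = hol''[THEN holomorphic_on_imp_continuous_on]
  have wi: "has_wirtinger f (deriv f z) 0 z" if "f holomorphic_on ?S" "z \<in> ?S" for f z
    by (rule has_wirtinger_holomorphic[OF that(1) _ that(2)]) auto
  have wic: "has_wirtinger (\<lambda>z. cnj (f z)) 0 (cnj (deriv f z)) z" if "f holomorphic_on ?S" "z \<in> ?S" for f z
    using has_wirtinger_cnj[OF wi[OF that]] by simp
  have nzD: "D z \<noteq> 0" if "z \<in> ?S" for z
    using nz[OF that] by (simp add: D_def)
  have cD: "continuous_on ?S D"
    unfolding D_def by (intro continuous_intros c)
  have cI: "continuous_on ?S (\<lambda>z. inverse (D z))"
    by (intro continuous_intros cD) (use nzD in auto)
  define N where "N = (\<lambda>z. cnj (B z) * t z + cnj (C z) * w z)"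
  define E where "E = (\<lambda>z. deriv B z * cnj (B z) + deriv C z * cnj (C z))"
  have cE: "continuous_on ?S E" and cN: "continuous_on ?S N"
    unfolding E_def N_def by (intro continuous_intros c)+
  define I where "I = (\<lambda>z. inverse (D z))"
  have wI: "has_wirtinger I (- E z * (I z)\<^sup>2) (- cnj (E z) * (I z)\<^sup>2) z" if z: "z \<in> ?S" for z
  proof -
    have "has_wirtinger D (E z) (cnj (E z)) z"
      unfolding D_def
      by (rule has_wirtinger_eq_rhs[OF has_wirtinger_add[OF has_wirtinger_mult[OF wi[OF hol(1) z] wic[OF hol(1) z]]
             has_wirtinger_mult[OF wi[OF hol(2) z] wic[OF hol(2) z]]]]) (simp_all add: E_def mult.commute)
    from has_wirtinger_inverse[OF this nzD[OF z]] show ?thesis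
      by (simp add: I_def field_simps)
  qed
  have ID: "I z * D z = 1" if "z \<in> ?S" for z using nzD[OF that] by (simp add: I_def)
  define a where "a = (\<lambda>z. (deriv x z * N z + x z * (cnj (B z) * deriv t z + cnj (C z) * deriv w z)) * I z
      - x z * N z * E z * (I z)\<^sup>2)"
  define b where "b = (\<lambda>z. x z * q z * cnj (W z) * (I z * I z))"
  have 1: "has_wirtinger (\<lambda>z. x z * N z * I z) (a z) (b z) z" if z: "z \<in> ?S" for z
  proof -
    have "has_wirtinger N (cnj (B z) * deriv t z + cnj (C z) * deriv w z)
        (cnj (deriv B z) * t z + cnj (deriv C z) * w z) z"
      unfolding N_def
      by (rule has_wirtinger_eq_rhs[OF has_wirtinger_add[OF has_wirtinger_mult[OF wic[OF hol(1) z] wi[OF hol(4) z]]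
             has_wirtinger_mult[OF wic[OF hol(2) z] wi[OF hol(5) z]]]]) simp_all
    from has_wirtinger_mult[OF has_wirtinger_mult[OF wi[OF hol(3) z] this] wI[OF z]]
    show ?thesis
    proof (rule has_wirtinger_eq_rhs)
      let ?X = "cnj (deriv B z) * t z + cnj (deriv C z) * w z"
      \<comment> \<open>The factor \<open>I z * D z = 1\<close> is inserted so that both terms carry
        \<open>I z * I z\<close>; the quotient-rule numerator that is left is factored by the
        identity \<open>3\<close>.\<close>
      have "(0 * N z + x z * ?X) * I z + x z * N z * (- cnj (E z) * (I z)\<^sup>2)
          = x z * ?X * I z * (I z * D z) - x z * N z * cnj (E z) * (I z * I z)"
        using ID[OF z] by (simp add: power2_eq_square)
      also have "\<dots> = x z * (I z * I z) * (?X * D z - N z * cnj (E z))"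
        by (simp add: algebra_simps)
      finally have 2: "(0 * N z + x z * ?X) * I z + x z * N z * (- cnj (E z) * (I z)\<^sup>2)
          = x z * (I z * I z) * (?X * D z - N z * cnj (E z))" .
      have 3: "(cnj (deriv B z) * t z + cnj (deriv C z) * w z) * D z - N z * cnj (E z) = q z * cnj (W z)"
        by (simp add: D_def N_def E_def q_def W_def algebra_simps)
      show "(0 * N z + x z * (cnj (deriv B z) * t z + cnj (deriv C z) * w z)) * I z +
         x z * N z * (- cnj (E z) * (I z)\<^sup>2) = b z"
        unfolding 2 3 by (simp add: b_def)
    qed (simp add: a_def algebra_simps)
  qed
  have 2: "has_wirtinger b
     (cnj (W z) * ((deriv x z * q z + x z * deriv q z) * (I z)\<^sup>2 - 2 * x z * q z * E z * (I z)^3))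
     (x z * q z * (cnj (deriv W z) * (I z)\<^sup>2 - 2 * cnj (W z) * cnj (E z) * (I z)^3)) z" if z: "z \<in> ?S" for z
    unfolding b_def
    by (rule has_wirtinger_eq_rhs[OF has_wirtinger_mult[OF has_wirtinger_mult[OF
         has_wirtinger_mult[OF wi[OF hol(3) z] wi[OF holq z]] wic[OF holW z]]
         has_wirtinger_mult[OF wI[OF z] wI[OF z]]]])
       (simp_all add: power2_eq_square power3_eq_cube algebra_simps)
  have cI': "continuous_on ?S I" using cI by (simp add: I_def)
  have eqs: "inverse (D z) = I z" "cnj (B z) * t z + cnj (C z) * w z = N z"
    "deriv B z * cnj (B z) + deriv C z * cnj (C z) = E z" for z
    by (simp_all add: I_def N_def E_def)
  show ?thesis
    unfolding has_ddbar_def eqs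
    apply (rule exI[of _ a], rule exI[of _ b],
      rule exI[of _ "\<lambda>z. x z * q z * (cnj (deriv W z) * (I z)\<^sup>2 - 2 * cnj (W z) * cnj (E z) * (I z)^3)"])
    apply (intro conjI ballI 1 2)
    unfolding a_def
    by (intro continuous_intros c cI' cE cN)+
qed


section \<open>Pointwise bounds for the Laplacian of the corona term\<close>

lemma complex_mult_cnj_cmod: "z * cnj z = of_real ((norm z)\<^sup>2)"
  by (simp only: complex_norm_square)

lemma norm_add_mult_cauchy_schwarz:
  fixes a b c d :: complex
  shows "norm (a * b + c * d) \<le> sqrt ((norm a)\<^sup>2 + (norm c)\<^sup>2) * sqrt ((norm b)\<^sup>2 + (norm d)\<^sup>2)"
proof -
  have "norm (a * b + c * d) \<le> norm a * norm b + norm c * norm d"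
    by (metis norm_mult norm_triangle_ineq)
  also have "\<dots> = inner (norm a, norm c) (norm b, norm d)"
    by simp
  also have "\<dots> \<le> norm (norm a, norm c) * norm (norm b, norm d)"
    by (rule norm_cauchy_schwarz)
  finally show ?thesis by (simp add: norm_Pair)
qed

lemma norm_add_sq_lower:
  fixes u v :: complex
  shows "(norm u)\<^sup>2 / 2 - (norm v)\<^sup>2 \<le> (norm (u + v))\<^sup>2"
proof -
  have "norm u \<le> norm (u + v) + norm v"
    using norm_triangle_ineq4[of "u + v" v] by simp
  then have "(norm u)\<^sup>2 \<le> (norm (u + v) + norm v)\<^sup>2"
    by (intro power_mono) auto
  also have "\<dots> \<le> 2 * (norm (u + v))\<^sup>2 + 2 * (norm v)\<^sup>2"
    using sum_squares_bound[of "norm (u + v)" "norm v"] by (simp add: power2_sum)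
  finally show ?thesis by simp
qed

text \<open>With \<open>g\<close>, \<open>b\<close>, \<open>c\<close> read as derivatives of
  \<open>f\<close>, \<open>B\<close>, \<open>C\<close>, the right-hand side is a quarter of the
  Laplacian of \<open>3 |f|^2 + |B f|^2 + |C f|^2\<close>. Of the three copies of
  \<open>(norm g)\<^sup>2\<close>, two pay for \<open>B * g\<close> and \<open>C * g\<close> and one
  remains.\<close>

lemma weighted_laplacian_lower:
  fixes B C b c f g :: complex
  assumes "norm B \<le> 1" "norm C \<le> 1"
  shows "(norm g)\<^sup>2 + ((norm b)\<^sup>2 + (norm c)\<^sup>2) * (norm f)\<^sup>2 / 2
    \<le> 3 * (norm g)\<^sup>2 + (norm (b * f + B * g))\<^sup>2 + (norm (c * f + C * g))\<^sup>2"
proof -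
  have "(norm (B * g))\<^sup>2 \<le> (norm g)\<^sup>2" "(norm (C * g))\<^sup>2 \<le> (norm g)\<^sup>2"
    using assms by (auto simp: norm_mult intro!: power_mono mult_left_le_one_le)
  with norm_add_sq_lower[of "b * f" "B * g"] norm_add_sq_lower[of "c * f" "C * g"]
  show ?thesis by (simp add: norm_mult power_mult_distrib algebra_simps add_divide_distrib)
qed

text \<open>Cauchy-Schwarz bounds both \<open>B * c - C * b\<close> and
  \<open>b * cnj B + c * cnj C\<close> by \<open>e * S\<close>, where \<open>e\<close> and
  \<open>S\<close> are the lengths of the vectors \<open>(B, C)\<close> and \<open>(b, c)\<close>.
  The resulting products of an \<open>x\<close>-quantity and a \<open>q\<close>-quantity are split
  by a weighted AM-GM inequality. The weight \<tau> stays free so that the \<open>x\<close>-part can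
  later be made small.\<close>

lemma corona_laplacian_bound:
  fixes B C b c x x' q q' :: complex and \<delta> \<tau> :: real
  assumes \<delta>: "0 < \<delta>" "\<delta> \<le> 1" and \<tau>: "0 < \<tau>"
    and le1: "norm B \<le> 1" "norm C \<le> 1" and low: "\<delta>\<^sup>2 \<le> (norm B)\<^sup>2 + (norm C)\<^sup>2"
  defines "D \<equiv> B * cnj B + C * cnj C"
  shows "norm (cnj (B * c - C * b) * ((x' * q + x * q') * (inverse D)\<^sup>2
      - 2 * x * q * (b * cnj B + c * cnj C) * (inverse D)^3))
    \<le> 3 / \<delta>^4 * (\<tau> * (3 * (norm x')\<^sup>2 + (norm (b * x + B * x'))\<^sup>2 + (norm (c * x + C * x'))\<^sup>2)
       + inverse \<tau> * (3 * (norm q')\<^sup>2 + (norm (b * q + B * q'))\<^sup>2 + (norm (c * q + C * q'))\<^sup>2))"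
proof -
  define e where "e = sqrt ((norm B)\<^sup>2 + (norm C)\<^sup>2)"
  define S where "S = sqrt ((norm b)\<^sup>2 + (norm c)\<^sup>2)"
  have S2: "(norm b)\<^sup>2 + (norm c)\<^sup>2 = S\<^sup>2" and S0: "S \<ge> 0" by (simp_all add: S_def)
  have e: "e \<ge> \<delta>" using real_le_rsqrt[OF low] by (simp add: e_def)
  then have e0: "e > 0" using \<delta> by simp
  have D: "D = of_real (e\<^sup>2)"
    by (simp add: D_def e_def complex_mult_cnj_cmod)
  have iD: "inverse D = of_real (inverse (e\<^sup>2))" by (simp add: D)
  have W: "norm (cnj (B * c - C * b)) \<le> e * S"
    using norm_add_mult_cauchy_schwarz[of B c "- C" b] by (simp add: e_def S_def add.commute del: complex_cnj_diff complex_cnj_mult)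
  have E: "norm (b * cnj B + c * cnj C) \<le> e * S"
    using norm_add_mult_cauchy_schwarz[of b "cnj B" c "cnj C"] by (simp add: e_def S_def mult.commute)
  let ?A = "norm x'" and ?b = "norm x" and ?u = "norm q" and ?v = "norm q'"
  have 1: "norm ((x' * q + x * q') * (inverse D)\<^sup>2 - 2 * x * q * (b * cnj B + c * cnj C) * (inverse D)^3)
     \<le> (?A * ?u + ?b * ?v) * inverse (e^4) + 2 * ?b * ?u * (e * S) * inverse (e^6)"
  proof (rule order_trans[OF norm_triangle_ineq4 add_mono])
    show "norm ((x' * q + x * q') * (inverse D)\<^sup>2) \<le> (?A * ?u + ?b * ?v) * inverse (e^4)"
      unfolding norm_mult iD
      using norm_triangle_ineq[of "x' * q" "x * q'"] e0
      by (intro mult_mono) (auto simp: norm_mult norm_power norm_inverse power_inverse power_mult[symmetric])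
    show "norm (2 * x * q * (b * cnj B + c * cnj C) * (inverse D)^3) \<le> 2 * ?b * ?u * (e * S) * inverse (e^6)"
      unfolding norm_mult iD
      using E e0 S0
      by (intro mult_mono) (auto simp: norm_mult norm_power norm_inverse power_inverse power_mult[symmetric])
  qed
  have ie: "inverse e \<le> inverse \<delta>" using e \<delta> by (simp add: le_imp_inverse_le)
  have i\<delta>: "1 \<le> inverse \<delta>" using \<delta> by (simp add: one_le_inverse_iff)
  \<comment> \<open>The exponent is raised to 4, which \<delta> \<le> 1 permits, so that both terms
    share one constant.\<close>
  have ie3: "inverse e ^ 3 \<le> inverse \<delta> ^ 4"
  proof -
    have "inverse e ^ 3 \<le> inverse \<delta> ^ 3" using ie e0 by (intro power_mono) auto
    also have "\<dots> \<le> inverse \<delta> ^ 4" using i\<delta> by (intro power_increasing) auto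
    finally show ?thesis .
  qed
  have ie4: "inverse e ^ 4 \<le> inverse \<delta> ^ 4" using ie e0 by (intro power_mono) auto
  define P where "P = S * ?A * ?u + S * ?b * ?v"
  define Q where "Q = S\<^sup>2 * ?b * ?u"
  have PQ0: "P \<ge> 0" "Q \<ge> 0" using S0 by (simp_all add: P_def Q_def)
  have "norm (cnj (B * c - C * b) * ((x' * q + x * q') * (inverse D)\<^sup>2
      - 2 * x * q * (b * cnj B + c * cnj C) * (inverse D)^3)) \<le>
     e * S * ((?A * ?u + ?b * ?v) * inverse (e^4) + 2 * ?b * ?u * (e * S) * inverse (e^6))"
    unfolding norm_mult[of "cnj _"]
    by (intro mult_mono W 1) (use e0 S0 in auto)
  also have "\<dots> = P * inverse e ^ 3 + 2 * Q * inverse e ^ 4"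
    using e0 by (simp add: P_def Q_def field_simps eval_nat_numeral)
  also have "\<dots> \<le> P * inverse \<delta> ^ 4 + 2 * Q * inverse \<delta> ^ 4"
    using PQ0 ie3 ie4 by (intro add_mono mult_left_mono) auto
  also have "\<dots> = inverse \<delta> ^ 4 * (P + 2 * Q)" by (simp add: algebra_simps)
  also have "\<dots> \<le> inverse \<delta> ^ 4 * (3 * (\<tau> * (?A\<^sup>2 + S\<^sup>2 * ?b\<^sup>2 / 2) + inverse \<tau> * (?v\<^sup>2 + S\<^sup>2 * ?u\<^sup>2 / 2)))"
  proof (rule mult_left_mono)
    have amgm: "2 * (a * b) \<le> \<tau> * a\<^sup>2 + inverse \<tau> * b\<^sup>2" for a b
    proof -
      have "0 \<le> \<tau> * (a - inverse \<tau> * b)\<^sup>2" using \<tau> by simp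
      also have "\<dots> = \<tau> * a\<^sup>2 + inverse \<tau> * b\<^sup>2 - 2 * (a * b)"
        using \<tau> by (simp add: power2_eq_square field_simps)
      finally show ?thesis by simp
    qed
    have comb: "2 * a + 2 * b + 4 * c \<le> A + B + 2 * C" if "2 * a \<le> A" "2 * b \<le> B" "2 * c \<le> C"
      for a b c A B C :: real
      using that by linarith
    \<comment> \<open>Each of the three products pairs an \<open>x\<close>-quantity with a
      \<open>q\<close>-quantity, so \<tau> always lands on the \<open>x\<close>-side.\<close>
    have "2 * (?A * (S * ?u)) + 2 * ((S * ?b) * ?v) + 4 * ((S * ?b) * (S * ?u)) \<le>
       (\<tau> * ?A\<^sup>2 + inverse \<tau> * (S * ?u)\<^sup>2) + (\<tau> * (S * ?b)\<^sup>2 + inverse \<tau> * ?v\<^sup>2)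
       + 2 * (\<tau> * (S * ?b)\<^sup>2 + inverse \<tau> * (S * ?u)\<^sup>2)"
      by (rule comb[OF amgm amgm amgm])
    also have "\<dots> \<le> 6 * (\<tau> * (?A\<^sup>2 + S\<^sup>2 * ?b\<^sup>2 / 2) + inverse \<tau> * (?v\<^sup>2 + S\<^sup>2 * ?u\<^sup>2 / 2))"
      using \<tau> by (simp add: algebra_simps power_mult_distrib)
    finally show "P + 2 * Q \<le> 3 * (\<tau> * (?A\<^sup>2 + S\<^sup>2 * ?b\<^sup>2 / 2) + inverse \<tau> * (?v\<^sup>2 + S\<^sup>2 * ?u\<^sup>2 / 2))"
      by (simp add: P_def Q_def algebra_simps power2_eq_square)
  qed (use \<delta> in auto)
  also have "\<dots> \<le> inverse \<delta> ^ 4 * (3 * (\<tau> * (3 * (norm x')\<^sup>2 + (norm (b * x + B * x'))\<^sup>2 + (norm (c * x + C * x'))\<^sup>2)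
       + inverse \<tau> * (3 * (norm q')\<^sup>2 + (norm (b * q + B * q'))\<^sup>2 + (norm (c * q + C * q'))\<^sup>2)))"
    by (intro mult_left_mono add_mono[OF mult_left_mono mult_left_mono] weighted_laplacian_lower[OF le1, unfolded S2]
          weighted_laplacian_lower[OF le1, where b = b and c = c, unfolded S2]) (use \<tau> \<delta> in auto)
  finally show ?thesis by (simp add: field_simps)
qed


text \<open>The function \<open>U\<close> adds to \<open>- F\<close> enough squared moduli to have
  nonnegative Laplacian. Since \<open>Re (U 0)\<close> is nonnegative, so is the real part of the
  circle mean of \<open>U\<close>; on the circle \<open>Re (U z)\<close> is at most a multiple of
  \<open>|y|^2\<close> minus \<open>|x|^2 / 2\<close>, and integration gives the claim.\<close>

lemma corona_circle_estimate:
  fixes B C x t w y :: "complex \<Rightarrow> complex" and \<delta> :: real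
  assumes \<delta>: "0 < \<delta>" "\<delta> \<le> 1"
    and hol: "B holomorphic_on ball 0 1" "C holomorphic_on ball 0 1" "x holomorphic_on ball 0 1"
      "t holomorphic_on ball 0 1" "w holomorphic_on ball 0 1"
    and cont: "continuous_on (cball 0 1) B" "continuous_on (cball 0 1) C" "continuous_on (cball 0 1) x"
      "continuous_on (cball 0 1) t" "continuous_on (cball 0 1) w" "continuous_on (sphere 0 1) y"
    and le1: "\<And>z. z \<in> ball 0 1 \<Longrightarrow> norm (B z) \<le> 1" "\<And>z. z \<in> ball 0 1 \<Longrightarrow> norm (C z) \<le> 1"
    and low: "\<And>z. z \<in> ball 0 1 \<Longrightarrow> \<delta>\<^sup>2 \<le> (norm (B z))\<^sup>2 + (norm (C z))\<^sup>2"
    and circ: "\<And>z. norm z = 1 \<Longrightarrow> norm (B z) = 1" "\<And>z. norm z = 1 \<Longrightarrow> norm (C z) = 1"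
      "\<And>z. norm z = 1 \<Longrightarrow> t z = B z * cnj (x z - y z)" "\<And>z. norm z = 1 \<Longrightarrow> w z = C z * cnj (x z)"
    and zero: "t 0 = 0" "w 0 = 0"
  shows "integral {0..2*pi} (\<lambda>s. (norm (x (cis s)))\<^sup>2)
    \<le> (200 * (3 / \<delta>^4)\<^sup>2 + 1/2) * integral {0..2*pi} (\<lambda>s. (norm (y (cis s)))\<^sup>2)"
proof -
  define K where "K = 3 / \<delta>^4"
  define \<tau> where "\<tau> = 1 / (20 * K)" \<comment> \<open>lets the \<open>x\<close>-part of \<open>K * G\<close> be absorbed into the left-hand side\<close>
  have K: "K > 0" using \<delta> by (simp add: K_def)
  then have \<tau>: "\<tau> > 0" by (simp add: \<tau>_def)
  define \<sigma> where "\<sigma> = inverse \<tau>"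
  define D where "D = (\<lambda>z. B z * cnj (B z) + C z * cnj (C z))"
  define q where "q = (\<lambda>z. B z * w z - C z * t z)"
  define F where "F = (\<lambda>z. x z * (cnj (B z) * t z + cnj (C z) * w z) * inverse (D z))"
  define G where "G = (\<lambda>f z. 3 * (f z * cnj (f z)) + (B z * f z) * cnj (B z * f z) + (C z * f z) * cnj (C z * f z))"
  define L where "L = (\<lambda>f z. 3 * (deriv f z * cnj (deriv f z))
     + deriv (\<lambda>z. B z * f z) z * cnj (deriv (\<lambda>z. B z * f z) z)
     + deriv (\<lambda>z. C z * f z) z * cnj (deriv (\<lambda>z. C z * f z) z))"
  define U where "U = (\<lambda>z. of_real K * (of_real \<tau> * G x z + of_real (\<sigma>) * G q z) + (- 1) * F z)"
  have D: "D z = of_real ((norm (B z))\<^sup>2 + (norm (C z))\<^sup>2)" for z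
    by (simp add: D_def complex_mult_cnj_cmod)
  \<comment> \<open>The lower bound \<open>low\<close> covers only the open disc; on the circle both
    moduli equal 1.\<close>
  have D0: "D z \<noteq> 0" if "z \<in> cball 0 1" for z
  proof -
    have "(norm (B z))\<^sup>2 + (norm (C z))\<^sup>2 > 0"
    proof (cases "norm z = 1")
      case False
      then show ?thesis
        using less_le_trans[OF zero_less_power[OF \<delta>(1)] low[of z]] that by simp
    qed (use circ(1,2) in simp)
    then show ?thesis unfolding D of_real_eq_0_iff by (rule less_imp_neq[symmetric])
  qed
  have holq: "q holomorphic_on ball 0 1"
    unfolding q_def by (intro holomorphic_intros hol)
  have contq: "continuous_on (cball 0 1) q"
    unfolding q_def by (intro continuous_intros cont)
  have contU: "continuous_on (cball 0 1) U"
    unfolding U_def G_def F_def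
    by (intro continuous_intros cont contq) (use D0 in \<open>auto simp: D_def intro!: continuous_intros cont\<close>)
  have GL: "has_ddbar (G f) (L f)" if "f holomorphic_on ball 0 1" for f
    unfolding G_def L_def
    by (intro has_ddbar_add has_ddbar_cmult has_ddbar_holomorphic_mult_cnj holomorphic_intros that hol)
  have "\<exists>c. has_ddbar U c \<and> (\<forall>z\<in>ball 0 1. Re (c z) \<ge> 0)"
  proof -
    define c where "c = (\<lambda>z. cnj (B z * deriv C z - C z * deriv B z) * ((deriv x z * q z + x z * deriv q z) * (inverse (D z))\<^sup>2
      - 2 * x z * q z * (deriv B z * cnj (B z) + deriv C z * cnj (C z)) * (inverse (D z))^3))"
    have F: "has_ddbar F c"
      unfolding c_def F_def D_def q_def
      by (rule has_ddbar_corona[OF hol]) (use D0 in \<open>simp add: D_def\<close>)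
    have "has_ddbar U (\<lambda>z. of_real K * (of_real \<tau> * L x z + of_real (\<sigma>) * L q z) + (- 1) * c z)"
      unfolding U_def by (intro has_ddbar_add has_ddbar_cmult GL F hol holq)
    moreover have "Re (of_real K * (of_real \<tau> * L x z + of_real (\<sigma>) * L q z) + (- 1) * c z) \<ge> 0"
      if z: "z \<in> ball 0 1" for z
    proof -
      have L: "L f z = of_real (3 * (norm (deriv f z))\<^sup>2 + (norm (deriv B z * f z + B z * deriv f z))\<^sup>2
          + (norm (deriv C z * f z + C z * deriv f z))\<^sup>2)" if f: "f holomorphic_on ball 0 1" for f
      proof -
        have d: "g field_differentiable at z" if "g holomorphic_on ball 0 1" for g
          by (rule holomorphic_on_imp_differentiable_at[OF that _ z]) simp
        have "deriv (\<lambda>z. B z * f z) z = deriv B z * f z + B z * deriv f z"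
          "deriv (\<lambda>z. C z * f z) z = deriv C z * f z + C z * deriv f z"
          by (simp_all add: d hol f)
        then show ?thesis by (simp only: L_def complex_mult_cnj_cmod) simp
      qed
      have "norm (c z) \<le> K * (\<tau> * Re (L x z) + \<sigma> * Re (L q z))"
        unfolding L[OF hol(3)] L[OF holq] c_def D_def K_def Re_complex_of_real
        by (rule corona_laplacian_bound[OF \<delta> \<tau> le1[OF z] low[OF z], folded \<sigma>_def])
      with complex_Re_le_cmod[of "c z"] show ?thesis by simp
    qed
    ultimately show ?thesis by blast
  qed
  then obtain c where c: "has_ddbar U c" "\<And>z. z \<in> ball 0 1 \<Longrightarrow> Re (c z) \<ge> 0" by blast
  \<comment> \<open>Since \<open>t\<close> and \<open>w\<close> vanish at 0, so do \<open>F\<close>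
    and \<open>q\<close>, and only squared moduli of \<open>x\<close> survive.\<close>
  have "U 0 = of_real (K * \<tau> * (3 * (norm (x 0))\<^sup>2 + (norm (B 0 * x 0))\<^sup>2 + (norm (C 0 * x 0))\<^sup>2))"
    unfolding U_def G_def F_def q_def zero complex_mult_cnj_cmod by simp
  then have "Re (U 0) \<ge> 0" using K \<tau> by simp
  with subharmonic_circle_mean[OF c contU] have *: "0 \<le> Re (integral {0..2*pi} (\<lambda>s. U (cis s)))"
    by (smt (verit) mult_nonneg_nonneg pi_ge_zero)
  have iU: "(\<lambda>s. U (cis s)) integrable_on {0..2*pi}"
    by (intro integrable_continuous_real continuous_on_compose2[OF contU]) (auto intro!: continuous_intros)
  have ix: "(\<lambda>s. (norm (x (cis s)))\<^sup>2) integrable_on {0..2*pi}"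
    by (intro integrable_continuous_real continuous_intros continuous_on_compose2[OF cont(3)]) (auto intro!: continuous_intros)
  have iy: "(\<lambda>s. (norm (y (cis s)))\<^sup>2) integrable_on {0..2*pi}"
    by (intro integrable_continuous_real continuous_intros continuous_on_compose2[OF cont(6)]) (auto intro!: continuous_intros)
  \<comment> \<open>Here \<open>G f z\<close> is \<open>5 * |f|^2\<close> and
    \<open>|q| = |y|\<close>, while \<open>Re (F z)\<close> is at least
    \<open>3/4 * |x|^2 - 1/4 * |y|^2\<close>. The choice of \<tau> turns the weight of
    \<open>|x|^2\<close> coming from \<open>G\<close> into \<open>5 * K * \<tau> = 1/4\<close>,
    which leaves \<open>-1/2\<close>; the weight for \<open>|y|^2\<close> is
    \<open>5 * K * \<sigma> = 100 * K^2\<close>.\<close>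
  have pw: "Re (U z) \<le> (100 * K\<^sup>2 + 1/4) * (norm (y z))\<^sup>2 - 1/2 * (norm (x z))\<^sup>2" if z: "norm z = 1" for z
  proof -
    note c = circ(1,2)[OF z]
    have q: "norm (q z) = norm (y z)"
    proof -
      have "q z = B z * C z * cnj (y z)"
        unfolding q_def circ(3,4)[OF z] by (simp add: algebra_simps)
      then show ?thesis by (simp add: c norm_mult)
    qed
    have G: "G f z = of_real (5 * (norm (f z))\<^sup>2)" for f
      unfolding G_def complex_mult_cnj_cmod by (simp add: norm_mult c)
    have BC: "B z * cnj (B z) = 1" "C z * cnj (C z) = 1"
      by (simp_all add: complex_mult_cnj_cmod c)
    have "cnj (B z) * t z + cnj (C z) * w z = (B z * cnj (B z)) * cnj (x z - y z) + (C z * cnj (C z)) * cnj (x z)"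
      unfolding circ(3,4)[OF z] by (simp add: algebra_simps)
    also have "\<dots> = 2 * cnj (x z) - cnj (y z)" unfolding BC by simp
    finally have N: "cnj (B z) * t z + cnj (C z) * w z = 2 * cnj (x z) - cnj (y z)" .
    have "F z = x z * cnj (x z) - x z * cnj (y z) / 2"
      unfolding F_def D_def BC N by (simp add: algebra_simps)
    then have F: "Re (F z) = (norm (x z))\<^sup>2 - Re (x z * cnj (y z)) / 2"
      unfolding complex_mult_cnj_cmod by simp
    have "Re (x z * cnj (y z)) \<le> norm (x z) * norm (y z)"
      using complex_Re_le_cmod[of "x z * cnj (y z)"] by (simp add: norm_mult)
    also have "\<dots> \<le> ((norm (x z))\<^sup>2 + (norm (y z))\<^sup>2) / 2"
      using sum_squares_bound[of "norm (x z)" "norm (y z)"] by simp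
    finally have le: "Re (x z * cnj (y z)) \<le> ((norm (x z))\<^sup>2 + (norm (y z))\<^sup>2) / 2" .
    have "f \<ge> 3/4 * X - 1/4 * Y" if "r \<le> (X + Y) / 2" "f = X - r / 2" for f r X Y :: real
      using that by (simp add: field_simps)
    from this[OF le F] have F': "Re (F z) \<ge> 3/4 * (norm (x z))\<^sup>2 - 1/4 * (norm (y z))\<^sup>2" .
    have "Re (U z) = K * (\<tau> * (5 * (norm (x z))\<^sup>2) + \<sigma> * (5 * (norm (y z))\<^sup>2)) - Re (F z)"
      unfolding U_def G q by simp
    also have "K * (\<tau> * (5 * (norm (x z))\<^sup>2) + \<sigma> * (5 * (norm (y z))\<^sup>2)) =
       1/4 * (norm (x z))\<^sup>2 + 100 * K\<^sup>2 * (norm (y z))\<^sup>2"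
      using K by (simp add: \<sigma>_def \<tau>_def field_simps power2_eq_square)
    finally show ?thesis using F' unfolding distrib_right by linarith
  qed
  have "Re (integral {0..2*pi} (\<lambda>s. U (cis s))) = integral {0..2*pi} (\<lambda>s. Re (U (cis s)))"
    using integral_linear[OF iU bounded_linear_Re] by (simp add: o_def)
  also have "\<dots> \<le> integral {0..2*pi} (\<lambda>s. (100 * K\<^sup>2 + 1/4) * (norm (y (cis s)))\<^sup>2 - 1/2 * (norm (x (cis s)))\<^sup>2)"
    by (intro integral_le integrable_linear[OF iU bounded_linear_Re, unfolded o_def] integrable_diff
         integrable_on_mult_right ix iy pw) (simp_all only: norm_cis)
  also have "\<dots> = (100 * K\<^sup>2 + 1/4) * integral {0..2*pi} (\<lambda>s. (norm (y (cis s)))\<^sup>2)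
       - 1/2 * integral {0..2*pi} (\<lambda>s. (norm (x (cis s)))\<^sup>2)"
    by (subst integral_diff) (auto intro!: integrable_on_mult_right ix iy)
  finally show ?thesis using * unfolding K_def by (simp add: algebra_simps)
qed

section \<open>Elements of the Hardy space as power series\<close>

definition h2_fps :: "hardy2 \<Rightarrow> complex fps" where
  "h2_fps f = Abs_fps (h2_coeff f)"

lemma h2_fps_nth [simp]: "fps_nth (h2_fps f) n = h2_coeff f n"
  by (simp add: h2_fps_def)

lemma h2_fun_holomorphic: "h2_fun f holomorphic_on ball 0 1"
  using h2_fun[of f] by simp

lemma h2_fps_eq_expansion: "h2_fps f = fps_expansion (h2_fun f) 0"
  by (simp add: fps_eq_iff fps_expansion_def h2_coeff.rep_eq taylor0_def)

lemma conv_radius_h2_fps: "fps_conv_radius (h2_fps f) \<ge> 1"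
  unfolding h2_fps_eq_expansion
  using conv_radius_fps_expansion[of "h2_fun f" 0 1] h2_fun_holomorphic[of f] by (simp add: one_ereal_def)

lemma eval_h2_fps: "norm z < 1 \<Longrightarrow> eval_fps (h2_fps f) z = h2_fun f z"
  unfolding h2_fps_eq_expansion
  using eval_fps_expansion'[of "h2_fun f" 0 1 z] h2_fun_holomorphic[of f] by (simp add: one_ereal_def)

lemma h2_fps_inject: "h2_fps f = h2_fps g \<Longrightarrow> f = g"
  by (intro h2_eqI) (metis h2_fps_nth)

lemma h2_fps_add: "h2_fps (f + g) = h2_fps f + h2_fps g"
  by (simp add: fps_eq_iff h2_coeff_add)

lemma h2_fps_scaleC: "h2_fps (scaleC_h2 c f) = fps_const c * h2_fps f"
  by (simp add: fps_eq_iff h2_coeff_scaleC)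

lemma h2_fps_zero: "h2_fps 0 = 0"
  by (simp add: fps_eq_iff h2_coeff_zero)

lemma h2_fps_diff: "h2_fps (f - g) = h2_fps f - h2_fps g"
  using h2_fps_add[of "f - g" g] by (simp add: algebra_simps)

definition h2_of_fps :: "complex fps \<Rightarrow> hardy2" where
  "h2_of_fps F = Abs_hardy2 (\<lambda>z. if norm z < 1 then eval_fps F z else 0)"

text \<open>A radius of convergence beyond 1 makes the coefficients absolutely summable; being
  eventually below 1 in modulus, they are then square-summable.\<close>

lemma h2_fps_of_fps:
  assumes "fps_conv_radius F > 1"
  shows "h2_fps (h2_of_fps F) = F"
proof -
  define g where "g = (\<lambda>z. if norm z < 1 then eval_fps F z else 0)"
  have "ereal (norm z) < fps_conv_radius F" if "norm z < 1" for z :: complex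
    by (rule less_trans[OF _ assms]) (use that in simp)
  then have "eval_fps F holomorphic_on ball 0 1"
    by (intro holomorphic_on_eval_fps) auto
  then have hol: "g holomorphic_on ball 0 1"
    by (rule holomorphic_transform) (auto simp: g_def)
  have "g has_fps_expansion F"
    unfolding has_fps_expansion_def
  proof
    show "0 < fps_conv_radius F" by (rule less_trans[OF _ assms]) simp
    have "eventually (\<lambda>z. z \<in> ball 0 (1::real)) (nhds (0::complex))"
      by (intro eventually_nhds_in_open) auto
    then show "\<forall>\<^sub>F z in nhds 0. eval_fps F z = g z"
      by eventually_elim (auto simp: g_def)
  qed
  then have exp: "fps_expansion g 0 = F" by (rule fps_expansion_eqI)
  have t: "taylor0 g n = fps_nth F n" for n
    using arg_cong[OF exp, of "\<lambda>F. fps_nth F n"] by (simp add: taylor0_def fps_expansion_def)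
  have "summable (\<lambda>n. norm (fps_nth F n * 1 ^ n))"
    by (rule norm_summable_fps) (use assms in \<open>simp add: one_ereal_def\<close>)
  then have s: "summable (\<lambda>n. norm (fps_nth F n))" by simp
  have "eventually (\<lambda>n. norm (fps_nth F n) < 1) sequentially"
    using summable_LIMSEQ_zero[OF s] by (rule order_tendstoD) simp
  then have "eventually (\<lambda>n. norm ((norm (fps_nth F n))\<^sup>2) \<le> norm (fps_nth F n)) sequentially"
    by eventually_elim (simp add: power2_eq_square mult_left_le_one_le)
  from summable_comparison_test_ev[OF this s]
  have "summable (\<lambda>n. (norm (taylor0 g n))\<^sup>2)" by (simp add: t)
  then have "h2_fun (Abs_hardy2 g) = g"
    using hol by (intro Abs_hardy2_inverse) (auto simp: g_def)
  then show ?thesis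
    using exp by (simp add: h2_fps_eq_expansion h2_of_fps_def g_def)
qed

section \<open>Parseval's identity on the unit circle\<close>

lemma cis_integral:
  "((\<lambda>s. cis (of_int k * s)) has_integral (if k = 0 then 2 * pi else 0)) {0..2*pi}"
proof (cases "k = 0")
  case True
  then show ?thesis
    using has_integral_const_real[of "1::complex" 0 "2*pi"] by (simp add: scaleR_conv_of_real)
next
  case False
  have d: "((\<lambda>s. cis (of_int k * s) / (\<i> * of_int k)) has_vector_derivative cis (of_int k * s)) (at s within {0..2*pi})" for s
  proof -
    have "((\<lambda>s. cis (of_int k * s)) has_derivative (\<lambda>h. (of_int k * h) *\<^sub>R (\<i> * cis (of_int k * s)))) (at s within {0..2*pi})"
      by (auto intro!: derivative_eq_intros)
    then have "((\<lambda>s. inverse (\<i> * of_int k) * cis (of_int k * s)) has_derivative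
       (\<lambda>h. inverse (\<i> * of_int k) * ((of_int k * h) *\<^sub>R (\<i> * cis (of_int k * s))))) (at s within {0..2*pi})"
      by (rule has_derivative_mult_right)
    moreover have "inverse (\<i> * of_int k) * ((of_int k * h) *\<^sub>R (\<i> * cis (of_int k * s))) = h *\<^sub>R cis (of_int k * s)" for h
    proof -
      have "(of_int k * h) *\<^sub>R (\<i> * cis (of_int k * s)) = (\<i> * of_int k) * (h *\<^sub>R cis (of_int k * s))"
        by (simp add: scaleR_conv_of_real mult_ac)
      moreover have "\<i> * of_int k \<noteq> (0::complex)" using False by simp
      moreover have "inverse w * (w * v) = v" if "w \<noteq> 0" for w v :: complex
        using that by simp
      ultimately show ?thesis by metis
    qed
    ultimately show ?thesis
      by (simp only: has_vector_derivative_def divide_inverse mult.commute)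
  qed
  have "((\<lambda>s. cis (of_int k * s)) has_integral
      (cis (of_int k * (2 * pi)) / (\<i> * of_int k) - cis (of_int k * 0) / (\<i> * of_int k))) {0..2*pi}"
    by (rule fundamental_theorem_of_calculus[OF _ d]) simp
  moreover have "cis (of_int k * (2 * pi)) = 1"
    using cis_multiple_2pi[of "of_int k"] by (simp add: mult_ac)
  ultimately show ?thesis using False by simp
qed

text \<open>The square expands into a double sum of characters, and only its diagonal has nonzero
  integral.\<close>

lemma trig_poly_sq_integral:
  "integral {0..2*pi} (\<lambda>s. (norm (\<Sum>n<N. c n * cis s ^ n))\<^sup>2) = 2 * pi * (\<Sum>n<N. (norm (c n))\<^sup>2)"
proof -
  have "((\<lambda>s. \<Sum>n<N. \<Sum>m<N. c n * cnj (c m) * cis (of_int (int n - int m) * s)) has_integral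
     (\<Sum>n<N. \<Sum>m<N. c n * cnj (c m) * (if int n - int m = 0 then 2 * pi else 0))) {0..2*pi}"
    by (intro has_integral_sum has_integral_mult_right cis_integral finite_lessThan)
  also have "(\<Sum>n<N. \<Sum>m<N. c n * cnj (c m) * (if int n - int m = 0 then 2 * pi else 0))
     = of_real (2 * pi * (\<Sum>n<N. (norm (c n))\<^sup>2))"
  proof -
    have "(\<Sum>m<N. c n * cnj (c m) * (if int n - int m = 0 then 2 * pi else 0)) = of_real (2 * pi * (norm (c n))\<^sup>2)"
      if "n < N" for n
    proof -
      have "(\<Sum>m<N. c n * cnj (c m) * (if int n - int m = 0 then 2 * pi else 0))
         = (\<Sum>m<N. if m = n then of_real (2 * pi) * (c n * cnj (c n)) else 0)"
        by (rule sum.cong) auto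
      also have "\<dots> = of_real (2 * pi * (norm (c n))\<^sup>2)"
        using that by (simp only: sum.delta finite_lessThan lessThan_iff if_True of_real_mult complex_norm_square)
      finally show ?thesis .
    qed
    then show ?thesis by (simp add: sum_distrib_left)
  qed
  also have "(\<lambda>s. \<Sum>n<N. \<Sum>m<N. c n * cnj (c m) * cis (of_int (int n - int m) * s))
     = (\<lambda>s. of_real ((norm (\<Sum>n<N. c n * cis s ^ n))\<^sup>2))"
  proof
    fix s
    have e: "cis s ^ n * cnj (cis s ^ m) = cis (of_int (int n - int m) * s)" for n m
    proof -
      have "cis s ^ n * cnj (cis s ^ m) = cis (real n * s + real m * (- s))"
        by (simp only: complex_cnj_power cis_cnj Complex.DeMoivre cis_mult mult_minus_right)
      also have "\<dots> = cis (of_int (int n - int m) * s)"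
        by (rule arg_cong[of _ _ cis]) (simp add: algebra_simps)
      finally show ?thesis .
    qed
    have "c n * cnj (c m) * cis (of_int (int n - int m) * s) = (c n * cis s ^ n) * cnj (c m * cis s ^ m)" for n m
      unfolding e[symmetric] complex_cnj_mult by (simp only: mult_ac)
    then show "(\<Sum>n<N. \<Sum>m<N. c n * cnj (c m) * cis (of_int (int n - int m) * s))
      = of_real ((norm (\<Sum>n<N. c n * cis s ^ n))\<^sup>2)"
      by (simp only: complex_norm_square cnj_sum sum_product)
  qed
  finally have "((\<lambda>s. Re (of_real ((norm (\<Sum>n<N. c n * cis s ^ n))\<^sup>2))) has_integral
      Re (of_real (2 * pi * (\<Sum>n<N. (norm (c n))\<^sup>2)))) {0..2*pi}"
    using has_integral_linear[OF _ bounded_linear_Re] unfolding o_def by blast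
  then show ?thesis by (simp only: Re_complex_of_real integral_unique)
qed

text \<open>The partial sums are trigonometric polynomials, bounded on the circle by the sum
  \<open>M\<close> of the moduli of the coefficients; dominated convergence passes to the
  limit.\<close>

lemma circle_parseval:
  assumes "fps_conv_radius F > 1"
  shows "integral {0..2*pi} (\<lambda>s. (norm (eval_fps F (cis s)))\<^sup>2) = 2 * pi * (\<Sum>n. (norm (fps_nth F n))\<^sup>2)"
proof -
  have s: "summable (\<lambda>n. norm (fps_nth F n * z ^ n))" if "norm z \<le> 1" for z
    by (rule norm_summable_fps, rule le_less_trans[OF _ assms]) (use that in simp)
  from s[of 1] have s1: "summable (\<lambda>n. norm (fps_nth F n))" by simp
  define f where "f = (\<lambda>N s. (norm (\<Sum>n<N. fps_nth F n * cis s ^ n))\<^sup>2)"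
  define M where "M = (\<Sum>n. norm (fps_nth F n))"
  have "(\<lambda>N. integral {0..2*pi} (f N)) \<longlonglongrightarrow> integral {0..2*pi} (\<lambda>s. (norm (eval_fps F (cis s)))\<^sup>2)"
  proof (rule dominated_convergence)
    show "f N integrable_on {0..2*pi}" for N
      unfolding f_def by (intro integrable_continuous_real continuous_intros)
    show "(\<lambda>_. M\<^sup>2) integrable_on {0..2*pi}"
      by (intro integrable_continuous_real continuous_intros)
    show "norm (f N s) \<le> M\<^sup>2" if "s \<in> {0..2*pi}" for N s
    proof -
      have "norm (\<Sum>n<N. fps_nth F n * cis s ^ n) \<le> (\<Sum>n<N. norm (fps_nth F n))"
        by (rule order_trans[OF norm_sum]) (simp add: norm_mult norm_power)
      also have "\<dots> \<le> M"
        unfolding M_def by (rule sum_le_suminf[OF s1]) auto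
      finally show ?thesis by (simp add: f_def power_mono)
    qed
    show "(\<lambda>N. f N s) \<longlonglongrightarrow> (norm (eval_fps F (cis s)))\<^sup>2" for s
      unfolding f_def eval_fps_def
      by (intro tendsto_power tendsto_norm summable_LIMSEQ[OF summable_norm_cancel[OF s]]) simp
  qed
  moreover have "summable (\<lambda>n. (norm (fps_nth F n))\<^sup>2)"
    using h2_coeff_sq_summable[of "h2_of_fps F"] by (simp only: h2_fps_nth[symmetric] h2_fps_of_fps[OF assms])
  then have "(\<lambda>N. integral {0..2*pi} (f N)) \<longlonglongrightarrow> 2 * pi * (\<Sum>n. (norm (fps_nth F n))\<^sup>2)"
    unfolding f_def trig_poly_sq_integral by (intro tendsto_mult_left summable_LIMSEQ)
  ultimately show ?thesis by (rule LIMSEQ_unique)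
qed

lemma norm_h2_circle:
  assumes "fps_conv_radius (h2_fps f) > 1"
  shows "2 * pi * (norm f)\<^sup>2 = integral {0..2*pi} (\<lambda>s. (norm (eval_fps (h2_fps f) (cis s)))\<^sup>2)"
proof -
  have "(norm f)\<^sup>2 = (\<Sum>n. (norm (h2_coeff f n))\<^sup>2)"
    by (simp only: power2_norm_eq_inner inner_hardy2_def cinner_h2_self Re_complex_of_real)
  then show ?thesis unfolding circle_parseval[OF assms] by simp
qed

section \<open>Model spaces of finite Blaschke products\<close>

text \<open>The Hardy space pairing on bare power series. It also applies to a factor that is not
  known to be square-summable, such as the quotient of a Hardy function by a polynomial.\<close>

definition fps_pair :: "complex fps \<Rightarrow> complex fps \<Rightarrow> complex" where
  "fps_pair F U = (\<Sum>n. fps_nth F n * cnj (fps_nth U n))"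

lemma cinner_h2_fps_pair: "cinner_h2 f g = fps_pair (h2_fps f) (h2_fps g)"
  by (simp add: cinner_h2_def fps_pair_def)

text \<open>For some \<open>r > 1\<close> the coefficients of \<open>F\<close> are bounded by a
  multiple of \<open>r^-n\<close>, and those of \<open>U\<close> are absolutely summable against
  \<open>r^-n\<close>.\<close>

lemma summable_fps_pair:
  assumes "fps_conv_radius F > 1" "fps_conv_radius U \<ge> 1"
  shows "summable (\<lambda>n. fps_nth F n * cnj (fps_nth U n))"
proof -
  obtain r where r: "1 < ereal r" "ereal r < fps_conv_radius F"
    using ereal_dense2[OF assms(1)] by blast
  then have r1: "r > 1" by (simp add: one_ereal_def)
  have "summable (\<lambda>n. norm (fps_nth F n * of_real r ^ n))"
    by (rule norm_summable_fps) (use r r1 in simp)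
  then have "Bseq (\<lambda>n. norm (fps_nth F n * of_real r ^ n))"
    by (intro convergent_imp_Bseq convergentI[OF summable_LIMSEQ_zero])
  then obtain M where M: "\<And>n. norm (fps_nth F n * of_real r ^ n) \<le> M"
    by (auto simp: Bseq_def)
  have "ereal (norm (complex_of_real (inverse r))) < 1"
    using r1 by (simp add: norm_inverse one_ereal_def inverse_less_1_iff)
  then have "summable (\<lambda>n. norm (fps_nth U n * of_real (inverse r) ^ n))"
    by (intro norm_summable_fps less_le_trans[OF _ assms(2)])
  then have s: "summable (\<lambda>n. M * norm (fps_nth U n * of_real (inverse r) ^ n))"
    by (rule summable_mult)
  show ?thesis
  proof (rule summable_comparison_test'[OF s])
    fix n
    have "norm (fps_nth F n * cnj (fps_nth U n))
      = norm (fps_nth F n * of_real r ^ n) * norm (fps_nth U n * of_real (inverse r) ^ n)"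
      using r1 by (simp add: norm_mult norm_power norm_inverse power_inverse)
    also have "\<dots> \<le> M * norm (fps_nth U n * of_real (inverse r) ^ n)"
      by (intro mult_right_mono M) simp
    finally show "norm (fps_nth F n * cnj (fps_nth U n)) \<le> M * norm (fps_nth U n * of_real (inverse r) ^ n)" .
  qed
qed

lemma summable_fps_pair_poly: "summable (\<lambda>n. fps_nth F n * cnj (fps_nth (fps_of_poly r) n))"
  by (rule summable_finite[of "{..degree r}"]) (auto simp: coeff_eq_0)

text \<open>The adjoint of multiplication by \<open>a - z\<close>.\<close>

definition fps_adj :: "complex \<Rightarrow> complex fps \<Rightarrow> complex fps" where
  "fps_adj a F = fps_const (cnj a) * F - fps_shift 1 F"

lemma fps_pair_adjoint:
  assumes "summable (\<lambda>n. fps_nth F n * cnj (fps_nth U n))"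
    and "summable (\<lambda>n. fps_nth (fps_shift 1 F) n * cnj (fps_nth U n))"
  shows "fps_pair F ((fps_const a - fps_X) * U) = fps_pair (fps_adj a F) U"
proof -
  let ?A = "\<Sum>n. fps_nth F n * cnj (fps_nth U n)"
  let ?B = "\<Sum>n. fps_nth F (Suc n) * cnj (fps_nth U n)"
  have A: "(\<lambda>n. cnj a * (fps_nth F n * cnj (fps_nth U n))) sums (cnj a * ?A)"
    by (intro sums_mult summable_sums assms)
  have B: "(\<lambda>n. fps_nth F (Suc n) * cnj (fps_nth U n)) sums ?B"
    by (rule summable_sums) (use assms(2) in simp)
  then have "(\<lambda>n. fps_nth F (Suc n) * cnj (fps_nth (fps_X * U) (Suc n))) sums ?B" by simp
  from sums_Suc[OF this] have B': "(\<lambda>n. fps_nth F n * cnj (fps_nth (fps_X * U) n)) sums ?B" by simp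
  have "(\<lambda>n. fps_nth F n * cnj (fps_nth ((fps_const a - fps_X) * U) n)) sums (cnj a * ?A - ?B)"
    using sums_diff[OF A B'] by (simp add: algebra_simps)
  moreover have "(\<lambda>n. fps_nth (fps_adj a F) n * cnj (fps_nth U n)) sums (cnj a * ?A - ?B)"
    using sums_diff[OF A B] by (simp add: fps_adj_def algebra_simps)
  ultimately show ?thesis
    by (simp add: fps_pair_def sums_iff)
qed

text \<open>A finite Blaschke product is represented by the multiset of its zeros, so that products
  become sums of multisets and divisibility becomes inclusion. It equals \<open>numer\<close> over
  \<open>denom\<close>.\<close>

definition numer :: "complex multiset \<Rightarrow> complex poly" where
  "numer zs = (\<Prod>a\<in>#zs. [:a, - 1:])"

definition denom :: "complex multiset \<Rightarrow> complex poly" where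
  "denom zs = (\<Prod>a\<in>#zs. [:1, - cnj a:])"

definition bprod :: "complex multiset \<Rightarrow> complex \<Rightarrow> complex" where
  "bprod zs z = (\<Prod>a\<in>#zs. blaschke_factor a z)"

lemma numer_simps [simp]: "numer {#} = 1" "numer (add_mset a zs) = [:a, - 1:] * numer zs"
  "numer (zs + ys) = numer zs * numer ys"
  by (simp_all add: numer_def)

lemma denom_simps [simp]: "denom {#} = 1" "denom (add_mset a zs) = [:1, - cnj a:] * denom zs"
  "denom (zs + ys) = denom zs * denom ys"
  by (simp_all add: denom_def)

lemma bprod_simps [simp]: "bprod {#} z = 1" "bprod (add_mset a zs) z = blaschke_factor a z * bprod zs z"
  "bprod (zs + ys) z = bprod zs z * bprod ys z"
  by (simp_all add: bprod_def)

lemma bprod_eq: "bprod zs z = poly (numer zs) z / poly (denom zs) z"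
  by (induction zs) (simp_all add: blaschke_factor_def algebra_simps)

lemma degree_denom: "degree (denom zs) \<le> size zs"
proof (induction zs)
  case (add a zs)
  have "degree (denom (add_mset a zs)) \<le> degree [:1, - cnj a:] + degree (denom zs)"
    by (simp only: denom_simps degree_mult_le)
  also have "\<dots> \<le> Suc (size zs)" using add by (simp add: degree_pCons_eq_if)
  finally show ?case by simp
qed simp

lemma coeff_denom: "i > size zs \<Longrightarrow> coeff (denom zs) i = 0"
  using degree_denom[of zs] by (intro coeff_eq_0) simp

lemma poly_denom_nonzero:
  assumes "set_mset zs \<subseteq> ball 0 1" "norm z \<le> 1"
  shows "poly (denom zs) z \<noteq> 0"
  using assms(1)
proof (induction zs)
  case (add a zs)
  have "norm (cnj a * z) < 1"
    using add.prems assms(2) by (simp add: norm_mult mult_le_one) (metis mult.commute mult_less_cancel_right2 order_le_less_trans mult_left_le norm_ge_zero)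
  then have "1 - cnj a * z \<noteq> 0" by (metis norm_one order_less_irrefl right_minus_eq)
  then show ?case using add by (simp add: algebra_simps)
qed simp

lemma fps_of_poly_deg1: "fps_of_poly [:a, b :: complex:] = fps_const a + fps_const b * fps_X"
  by (simp add: fps_of_poly_pCons)

text \<open>Each factor is inverted by a geometric series whose radius of convergence exceeds 1
  because \<open>a\<close> lies in the open disc.\<close>

lemma denom_inverse_exists:
  assumes "set_mset zs \<subseteq> ball 0 1"
  obtains R where "fps_conv_radius R > 1" "R * fps_of_poly (denom zs) = 1"
    "\<And>z. norm z \<le> 1 \<Longrightarrow> eval_fps R z = 1 / poly (denom zs) z"
proof -
  have "\<exists>R. fps_conv_radius R > 1 \<and> R * fps_of_poly (denom zs) = 1"
    using assms
  proof (induction zs)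
    case empty
    then show ?case by (intro exI[of _ 1]) simp
  next
    case (add a zs)
    then obtain R where R: "fps_conv_radius R > 1" "R * fps_of_poly (denom zs) = 1" by auto
    define G where "G = Abs_fps (\<lambda>n. cnj a ^ n)"
    \<comment> \<open>A number strictly above 1 for which \<open>norm a * r\<close> is still below
      1, also when \<open>a = 0\<close>.\<close>
    define r where "r = 2 / (1 + norm a)"
    have a: "norm a < 1" using add.prems by simp
    have pos: "0 < 1 + norm a" by (simp add: add_pos_nonneg)
    have r: "r > 1" "norm a * r < 1"
      using a pos by (simp_all add: r_def divide_simps)
    have "summable (\<lambda>n. (cnj a * of_real r) ^ n)"
      by (rule summable_geometric) (use r in \<open>simp add: norm_mult\<close>)
    then have c1: "conv_radius (\<lambda>n. cnj a ^ n) \<ge> ereal (norm (complex_of_real r))"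
      by (intro conv_radius_geI) (simp add: power_mult_distrib)
    have c2: "1 < ereal (norm (complex_of_real r))" using r by simp
    have "fps_conv_radius G > 1"
      using less_le_trans[OF c2 c1] by (simp add: fps_conv_radius_def G_def)
    moreover have G1: "G * fps_of_poly [:1, - cnj a:] = 1"
    proof -
      have "G * fps_of_poly [:1, - cnj a:] = G - fps_const (cnj a) * (fps_X * G)"
        unfolding fps_of_poly_deg1 by (simp add: algebra_simps flip: fps_const_neg)
      also have "\<dots> = 1"
      proof (rule fps_ext)
        fix n show "fps_nth (G - fps_const (cnj a) * (fps_X * G)) n = fps_nth 1 n"
          by (cases n) (simp_all add: G_def)
      qed
      finally show ?thesis .
    qed
    ultimately have "fps_conv_radius (G * R) > 1"
      using R(1) by (intro less_le_trans[OF _ fps_conv_radius_mult]) simp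
    moreover have "(G * R) * fps_of_poly (denom (add_mset a zs)) = (G * fps_of_poly [:1, - cnj a:]) * (R * fps_of_poly (denom zs))"
      unfolding denom_simps fps_of_poly_mult by (simp only: mult_ac)
    ultimately show ?case
      unfolding G1 R(2) by (intro exI[of _ "G * R"] conjI) simp_all
  qed
  then obtain R where R: "fps_conv_radius R > 1" "R * fps_of_poly (denom zs) = 1" by blast
  moreover have "eval_fps R z = 1 / poly (denom zs) z" if z: "norm z \<le> 1" for z
  proof -
    have "ereal (norm z) < fps_conv_radius R" by (rule le_less_trans[OF _ R(1)]) (use z in simp)
    then have "eval_fps R z * poly (denom zs) z = 1"
      using arg_cong[OF R(2), of "\<lambda>F. eval_fps F z"] by (simp add: eval_fps_mult)
    then show ?thesis using poly_denom_nonzero[OF assms z] by (simp add: field_simps)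
  qed
  ultimately show ?thesis using that by blast
qed

text \<open>Multiplication by \<open>fps_X\<close> undoes the backward shift. Up to the constant
  \<open>fps_nth F 0\<close>, applying \<open>fps_adj a\<close> thus cancels one factor
  \<open>1 - cnj a * z\<close> from the denominator of \<open>F\<close>.\<close>

lemma fps_adj_mult_X: "fps_X * fps_adj a F = fps_const (fps_nth F 0) - fps_of_poly [:1, - cnj a:] * F"
proof -
  have "F = fps_const (fps_nth F 0) + fps_X * fps_shift 1 F"
    by (rule fps_ext) (simp add: fps_X_mult_nth)
  then have "fps_X * fps_shift 1 F = F - fps_const (fps_nth F 0)" by (metis add_diff_cancel_left')
  then show ?thesis
    by (simp add: fps_adj_def fps_of_poly_deg1 algebra_simps flip: fps_const_neg)
qed

text \<open>Degree below \<open>n\<close>, phrased by coefficients so that \<open>n = 0\<close>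
  forces the zero polynomial; \<open>degree\<close> would not distinguish it from a nonzero
  constant.\<close>

definition low_poly :: "nat \<Rightarrow> complex poly \<Rightarrow> bool" where
  "low_poly n p \<longleftrightarrow> (\<forall>i\<ge>n. coeff p i = 0)"

text \<open>A factor \<open>a - z\<close> of the numerator moves to the other side as the operator
  \<open>fps_adj a\<close>, which removes one factor of the denominator and lowers the degree bound
  by one. With all zeros used up, the degree bound leaves only 0.\<close>

lemma rational_orthogonal:
  assumes "set_mset zs \<subseteq> ball 0 1" "low_poly (size zs) p" "F * fps_of_poly (denom zs) = fps_of_poly p"
    and "fps_conv_radius U \<ge> 1" "fps_conv_radius F > 1"
  shows "fps_pair F (fps_of_poly (numer zs) * U) = 0"
  using assms
proof (induction zs arbitrary: p F)
  case empty
  then have "F = 0" by (simp add: low_poly_def poly_eq_iff)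
  then show ?case by (simp add: fps_pair_def)
next
  case (add a zs)
  define V where "V = fps_of_poly (numer zs) * U"
  have V: "fps_conv_radius V \<ge> 1"
    unfolding V_def by (rule order_trans[OF _ fps_conv_radius_mult]) (simp add: add.prems)
  define T where "T = fps_adj a F"
  define r where "r = Polynomial.smult (fps_nth F 0) (denom zs) - p"
  have XT: "fps_X * (T * fps_of_poly (denom zs)) = fps_of_poly r"
  proof -
    have "fps_X * (T * fps_of_poly (denom zs)) = (fps_X * T) * fps_of_poly (denom zs)" by (simp add: mult.assoc)
    also have "\<dots> = fps_const (fps_nth F 0) * fps_of_poly (denom zs) - F * fps_of_poly (denom (add_mset a zs))"
      unfolding T_def fps_adj_mult_X by (simp only: denom_simps fps_of_poly_mult) (simp add: algebra_simps)
    also have "\<dots> = fps_of_poly r"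
      unfolding r_def add.prems(3) by (simp add: fps_of_poly_diff fps_of_poly_smult)
    finally show ?thesis .
  qed
  have "coeff r 0 = fps_nth (fps_of_poly r) 0" by simp
  also have "\<dots> = 0" unfolding XT[symmetric] by simp
  finally have r0: "coeff r 0 = 0" .
  obtain p1 where p1: "r = pCons 0 p1" using r0 by (cases r) auto
  have "T * fps_of_poly (denom zs) = fps_of_poly p1"
    using XT unfolding p1 by (simp add: fps_of_poly_pCons mult.commute)
  moreover have "low_poly (size zs) p1"
    unfolding low_poly_def
  proof (intro allI impI)
    fix i assume "i \<ge> size zs"
    then have "coeff r (Suc i) = 0"
      using add.prems(2) coeff_denom[of zs "Suc i"] by (simp add: r_def low_poly_def)
    then show "coeff p1 i = 0" by (simp add: p1)
  qed
  moreover have cT: "fps_conv_radius T > 1"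
    unfolding T_def fps_adj_def
    by (rule less_le_trans[OF _ fps_conv_radius_diff])
      (use add.prems(5) in \<open>simp, intro less_le_trans[OF _ fps_conv_radius_mult], simp\<close>)
  ultimately have "fps_pair T V = 0"
    unfolding V_def using add by (intro add.IH[of p1]) auto
  moreover have "fps_of_poly (numer (add_mset a zs)) * U = (fps_const a - fps_X) * V"
    by (simp only: numer_simps fps_of_poly_mult V_def mult.assoc) (simp add: fps_of_poly_deg1 algebra_simps flip: fps_const_neg)
  moreover have "fps_pair F ((fps_const a - fps_X) * V) = fps_pair T V"
    unfolding T_def
    by (rule fps_pair_adjoint) (rule summable_fps_pair; use add.prems V in simp)+
  ultimately show ?case by metis
qed

text \<open>The same peeling run backwards: from the numerator \<open>p1\<close> for
  \<open>fps_adj a F\<close>, the numerator for \<open>F\<close> is recovered. Testing against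
  polynomials keeps every pairing a finite sum, so no convergence of \<open>F\<close> is
  assumed.\<close>

lemma orthogonal_rational:
  assumes "\<And>r. fps_pair F (fps_of_poly (numer zs * r)) = 0"
  shows "\<exists>p. low_poly (size zs) p \<and> F * fps_of_poly (denom zs) = fps_of_poly p"
  using assms
proof (induction zs arbitrary: F)
  case empty
  have "fps_nth F n = 0" for n
  proof -
    have "fps_pair F (fps_of_poly (monom 1 n)) = (\<Sum>k. if k = n then fps_nth F n else 0)"
      unfolding fps_pair_def by (rule suminf_cong) auto
    also have "\<dots> = fps_nth F n"
      using sums_unique[OF sums_single[of n "\<lambda>_. fps_nth F n"]] by simp
    finally show ?thesis using empty[of "monom 1 n"] by simp
  qed
  then have "F = 0" by (intro fps_ext) simp
  then show ?case by (intro exI[of _ 0]) (simp add: low_poly_def)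
next
  case (add a zs)
  define T where "T = fps_adj a F"
  have "fps_pair T (fps_of_poly (numer zs * r)) = 0" for r
  proof -
    have "fps_pair T (fps_of_poly (numer zs * r)) = fps_pair F ((fps_const a - fps_X) * fps_of_poly (numer zs * r))"
      unfolding T_def by (rule fps_pair_adjoint[symmetric]) (rule summable_fps_pair_poly)+
    also have "(fps_const a - fps_X) * fps_of_poly (numer zs * r) = fps_of_poly (numer (add_mset a zs) * r)"
      by (simp only: numer_simps fps_of_poly_mult mult.assoc) (simp add: fps_of_poly_deg1 algebra_simps flip: fps_const_neg)
    finally show ?thesis using add.prems by simp
  qed
  from add.IH[OF this] obtain p1 where p1: "low_poly (size zs) p1" "T * fps_of_poly (denom zs) = fps_of_poly p1"
    by blast
  define p where "p = Polynomial.smult (fps_nth F 0) (denom zs) - pCons 0 p1"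
  have "low_poly (size (add_mset a zs)) p"
    unfolding low_poly_def
  proof (intro allI impI)
    fix i assume i: "i \<ge> size (add_mset a zs)"
    then obtain j where "i = Suc j" "j \<ge> size zs" by (cases i) auto
    then show "coeff p i = 0"
      using p1(1) coeff_denom[of zs i] by (simp add: p_def low_poly_def)
  qed
  moreover have "F * fps_of_poly (denom (add_mset a zs)) = fps_of_poly p"
  proof -
    have "F * fps_of_poly (denom (add_mset a zs)) = (fps_of_poly [:1, - cnj a:] * F) * fps_of_poly (denom zs)"
      by (simp only: denom_simps fps_of_poly_mult mult_ac)
    also have "fps_of_poly [:1, - cnj a:] * F = fps_const (fps_nth F 0) - fps_X * T"
      unfolding T_def fps_adj_mult_X by simp
    also have "(fps_const (fps_nth F 0) - fps_X * T) * fps_of_poly (denom zs) =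
        fps_const (fps_nth F 0) * fps_of_poly (denom zs) - fps_X * (T * fps_of_poly (denom zs))"
      by (simp add: algebra_simps)
    also have "\<dots> = fps_of_poly p"
      unfolding p1(2) p_def by (simp add: fps_of_poly_diff fps_of_poly_smult fps_of_poly_pCons mult.commute)
    finally show ?thesis .
  qed
  ultimately show ?case by blast
qed

text \<open>The classical form of the model space of a finite Blaschke product: quotients
  \<open>p / denom zs\<close> with the degree of \<open>p\<close> below the number of zeros. The
  equation is multiplied out so that it lives among power series.\<close>

definition rational_space :: "complex multiset \<Rightarrow> hardy2 set" where
  "rational_space zs = {f. \<exists>p. low_poly (size zs) p \<and> h2_fps f * fps_of_poly (denom zs) = fps_of_poly p}"

lemma rational_conv_radius:
  assumes "set_mset zs \<subseteq> ball 0 1" "F * fps_of_poly (denom zs) = fps_of_poly p"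
  shows "fps_conv_radius F > 1" "norm z \<le> 1 \<Longrightarrow> eval_fps F z = poly p z / poly (denom zs) z"
proof -
  obtain R where R: "fps_conv_radius R > 1" "R * fps_of_poly (denom zs) = 1"
    "\<And>z. norm z \<le> 1 \<Longrightarrow> eval_fps R z = 1 / poly (denom zs) z"
    using denom_inverse_exists[OF assms(1)] by blast
  have F: "F = fps_of_poly p * R"
    using R(2) assms(2) by (metis mult.assoc mult.commute mult_1)
  show c: "fps_conv_radius F > 1"
    unfolding F by (rule less_le_trans[OF _ fps_conv_radius_mult]) (simp add: R)
  assume z: "norm z \<le> 1"
  have "ereal (norm z) < fps_conv_radius R" by (rule le_less_trans[OF _ R(1)]) (use z in simp)
  then show "eval_fps F z = poly p z / poly (denom zs) z"
    unfolding F by (subst eval_fps_mult) (simp_all add: R(3)[OF z])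
qed

text \<open>Orthogonality to the polynomial multiples of \<open>numer zs\<close> already forces the
  rational form. Conversely, an element of the multiplied space is \<open>numer zs\<close> times a
  power series converging in the disc, to which the peeling argument applies.\<close>

lemma model_space_eq_rational_space:
  assumes zs: "set_mset zs \<subseteq> ball 0 1"
  shows "model_space (bprod zs) = rational_space zs"
proof (intro equalityI subsetI)
  fix f assume f: "f \<in> model_space (bprod zs)"
  have "fps_pair (h2_fps f) (fps_of_poly (numer zs * r)) = 0" for r
  proof -
    \<comment> \<open>On the disc \<open>numer zs * r\<close> is the Blaschke product times
      \<open>denom zs * r\<close>, so \<open>g0\<close> witnesses membership of
      \<open>g\<close>.\<close>
    define g where "g = h2_of_fps (fps_of_poly (numer zs * r))"
    define g0 where "g0 = h2_of_fps (fps_of_poly (denom zs * r))"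
    have g: "h2_fps g = fps_of_poly (numer zs * r)" "h2_fps g0 = fps_of_poly (denom zs * r)"
      unfolding g_def g0_def by (rule h2_fps_of_fps; simp)+
    have "h2_fun g z = bprod zs z * h2_fun g0 z" if "z \<in> ball 0 1" for z
      using that poly_denom_nonzero[OF zs, of z]
      by (simp add: eval_h2_fps[symmetric] g bprod_eq)
    then have "g \<in> mult_h2 (bprod zs)" by (auto simp: mult_h2_def)
    with f have "cinner_h2 f g = 0" by (auto simp: model_space_def)
    then show ?thesis by (simp add: cinner_h2_fps_pair g)
  qed
  from orthogonal_rational[OF this] show "f \<in> rational_space zs"
    by (simp add: rational_space_def)
next
  fix f assume "f \<in> rational_space zs"
  then obtain p where p: "low_poly (size zs) p" "h2_fps f * fps_of_poly (denom zs) = fps_of_poly p"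
    by (auto simp: rational_space_def)
  obtain R where R: "fps_conv_radius R > 1" "R * fps_of_poly (denom zs) = 1"
    "\<And>z. norm z \<le> 1 \<Longrightarrow> eval_fps R z = 1 / poly (denom zs) z"
    using denom_inverse_exists[OF zs] by blast
  show "f \<in> model_space (bprod zs)"
    unfolding model_space_def
  proof (intro CollectI ballI)
    fix g assume "g \<in> mult_h2 (bprod zs)"
    then obtain g0 where g0: "\<And>z. z \<in> ball 0 1 \<Longrightarrow> h2_fun g z = bprod zs z * h2_fun g0 z"
      unfolding mult_h2_def by blast
    define U where "U = h2_fps g0 * R"
    have U: "fps_conv_radius U \<ge> 1"
      unfolding U_def
      by (rule order_trans[OF _ fps_conv_radius_mult]) (use conv_radius_h2_fps[of g0] R(1) in simp)
    have nU: "fps_conv_radius (fps_of_poly (numer zs) * U) \<ge> 1"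
      by (rule order_trans[OF _ fps_conv_radius_mult]) (simp add: U)
    have "h2_fps g = fps_of_poly (numer zs) * U"
    proof (rule eval_fps_eqD)
      show "fps_conv_radius (h2_fps g) > 0"
        by (rule less_le_trans[OF _ conv_radius_h2_fps]) simp
      show "fps_conv_radius (fps_of_poly (numer zs) * U) > 0"
        by (rule less_le_trans[OF _ nU]) simp
      have "eventually (\<lambda>z. z \<in> ball 0 (1::real)) (nhds (0::complex))"
        by (intro eventually_nhds_in_open) auto
      then show "\<forall>\<^sub>F z in nhds 0. eval_fps (h2_fps g) z = eval_fps (fps_of_poly (numer zs) * U) z"
      proof eventually_elim
        case (elim z)
        then have z: "norm z < 1" by simp
        have r: "ereal (norm z) < fps_conv_radius F" if "fps_conv_radius F \<ge> 1" for F :: "complex fps"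
          by (rule less_le_trans[OF _ that]) (use z in simp)
        show ?case
          using z R(1) g0[OF elim] by (simp add: eval_h2_fps U_def eval_fps_mult r U[unfolded U_def] conv_radius_h2_fps R(3) bprod_eq)
      qed
    qed
    then show "cinner_h2 f g = 0"
      unfolding cinner_h2_fps_pair
      using rational_orthogonal[OF zs p U rational_conv_radius(1)[OF zs p(2)]] by simp
  qed
qed

section \<open>Separation of two model spaces\<close>

lemma low_poly_add: "low_poly n p \<Longrightarrow> low_poly n q \<Longrightarrow> low_poly n (p + q)"
  by (simp add: low_poly_def)

lemma low_poly_smult: "low_poly n p \<Longrightarrow> low_poly n (Polynomial.smult c p)"
  by (simp add: low_poly_def)

lemma low_poly_mult:
  assumes "low_poly n p" "low_poly (Suc m) q"
  shows "low_poly (n + m) (p * q)"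
  unfolding low_poly_def
proof (intro allI impI)
  fix i assume i: "i \<ge> n + m"
  have "\<forall>k\<in>{..i}. coeff p k * coeff q (i - k) = 0"
  proof
    fix k assume "k \<in> {..i}"
    then show "coeff p k * coeff q (i - k) = 0"
      using assms i by (cases "k \<ge> n") (auto simp: low_poly_def)
  qed
  then show "coeff (p * q) i = 0" unfolding coeff_mult by (rule sum.neutral)
qed

lemma low_poly_denom: "low_poly (Suc (size zs)) (denom zs)"
  using coeff_denom by (simp add: low_poly_def Suc_le_eq)

lemma subspace_rational_space: "h2.subspace (rational_space zs)"
  unfolding h2.subspace_def
proof (intro conjI ballI allI)
  show "0 \<in> rational_space zs"
    by (auto simp: rational_space_def h2_fps_zero low_poly_def intro!: exI[of _ 0])
  fix f assume "f \<in> rational_space zs"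
  then obtain p where p: "low_poly (size zs) p" "h2_fps f * fps_of_poly (denom zs) = fps_of_poly p"
    by (auto simp: rational_space_def)
  {
    fix g assume "g \<in> rational_space zs"
    then obtain q where q: "low_poly (size zs) q" "h2_fps g * fps_of_poly (denom zs) = fps_of_poly q"
      by (auto simp: rational_space_def)
    show "f + g \<in> rational_space zs"
      unfolding rational_space_def
      by (intro CollectI exI[of _ "p + q"] conjI low_poly_add p q)
        (simp add: h2_fps_add distrib_right p q fps_of_poly_add)
  }
  show "scaleC_h2 c f \<in> rational_space zs" for c
    unfolding rational_space_def
    by (intro CollectI exI[of _ "Polynomial.smult c p"] conjI low_poly_smult p)
      (simp add: h2_fps_scaleC p fps_of_poly_smult mult.assoc)
qed

text \<open>The fraction is expanded by the denominator belonging to the additional zeros.\<close>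

lemma rational_space_mono:
  assumes "zs \<subseteq># ys"
  shows "rational_space zs \<subseteq> rational_space ys"
proof
  fix f assume "f \<in> rational_space zs"
  then obtain p where p: "low_poly (size zs) p" "h2_fps f * fps_of_poly (denom zs) = fps_of_poly p"
    by (auto simp: rational_space_def)
  obtain ws where ys: "ys = zs + ws" using assms by (auto simp: subset_mset.le_iff_add)
  have "low_poly (size ys) (p * denom ws)"
    unfolding ys size_union by (intro low_poly_mult p low_poly_denom)
  moreover have "h2_fps f * fps_of_poly (denom ys) = fps_of_poly (p * denom ws)"
    by (simp add: ys fps_of_poly_mult p(2)[symmetric] mult.assoc)
  ultimately show "f \<in> rational_space ys" by (auto simp: rational_space_def)
qed

lemma rational_space_element:
  assumes "set_mset zs \<subseteq> ball 0 1" "low_poly (size zs) p"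
  obtains f where "f \<in> rational_space zs" "h2_fps f * fps_of_poly (denom zs) = fps_of_poly p"
proof -
  obtain R where R: "fps_conv_radius R > 1" "R * fps_of_poly (denom zs) = 1"
    using denom_inverse_exists[OF assms(1)] by blast
  define f where "f = h2_of_fps (fps_of_poly p * R)"
  have "h2_fps f = fps_of_poly p * R"
    unfolding f_def
    by (rule h2_fps_of_fps, rule less_le_trans[OF _ fps_conv_radius_mult]) (simp add: R)
  then have "h2_fps f * fps_of_poly (denom zs) = fps_of_poly p"
    by (simp add: mult.assoc R)
  then show ?thesis using assms(2) that[of f] by (auto simp: rational_space_def)
qed

lemma scaleR_rational_space: "f \<in> rational_space zs \<Longrightarrow> r *\<^sub>R f \<in> rational_space zs"
  using subspace_rational_space by (simp add: scaleR_hardy2_def h2.subspace_scale)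

text \<open>A normalised \<open>1 / denom zs\<close>; the constant numerator meets the degree bound
  because there is at least one zero.\<close>

lemma rational_space_unit_vector:
  assumes "set_mset zs \<subseteq> ball 0 1" "zs \<noteq> {#}"
  obtains f where "f \<in> rational_space zs" "norm f = 1"
proof -
  have "low_poly (size zs) 1"
    unfolding low_poly_def
  proof (intro allI impI)
    fix i assume "size zs \<le> i"
    then have "i > 0" using assms(2) by (cases i) auto
    then show "coeff (1 :: complex poly) i = 0" by (intro coeff_eq_0) simp
  qed
  then obtain f where f: "f \<in> rational_space zs" "h2_fps f * fps_of_poly (denom zs) = fps_of_poly 1"
    by (rule rational_space_element[OF assms(1)])
  have "f \<noteq> 0" using f(2) by (auto simp: h2_fps_zero)
  then show ?thesis
    using that[of "(1 / norm f) *\<^sub>R f"] scaleR_rational_space[OF f(1)] by simp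
qed

section \<open>Finite Blaschke products on the closed disc and the circle\<close>

lemma norm_blaschke_factor:
  assumes "norm a < 1" "norm z \<le> 1"
  shows "norm (blaschke_factor a z) \<le> 1" "norm z = 1 \<Longrightarrow> norm (blaschke_factor a z) = 1"
proof -
  have nz: "1 - cnj a * z \<noteq> 0"
    using poly_denom_nonzero[of "{#a#}" z] assms by (simp add: mult.commute)
  \<comment> \<open>This identity settles both claims: the right-hand side is nonnegative in the
    closed disc and 0 on the circle.\<close>
  have id: "(norm (1 - cnj a * z))\<^sup>2 - (norm (a - z))\<^sup>2 = (1 - (norm a)\<^sup>2) * (1 - (norm z)\<^sup>2)"
    unfolding cmod_power2 by (simp add: power2_eq_square algebra_simps)
  have "0 \<le> (1 - (norm a)\<^sup>2) * (1 - (norm z)\<^sup>2)"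
    using assms by (intro mult_nonneg_nonneg) (simp_all add: power_le_one)
  then have "(norm (a - z))\<^sup>2 \<le> (norm (1 - cnj a * z))\<^sup>2" using id by linarith
  then have "norm (a - z) \<le> norm (1 - cnj a * z)" by (rule power2_le_imp_le) simp
  then show "norm (blaschke_factor a z) \<le> 1"
    using nz by (simp add: blaschke_factor_def norm_divide)
  assume "norm z = 1"
  then have "(norm (1 - cnj a * z))\<^sup>2 = (norm (a - z))\<^sup>2" using id by simp
  then have "norm (1 - cnj a * z) = norm (a - z)" by (rule power2_eq_imp_eq) simp_all
  moreover have "norm (1 - cnj a * z) \<noteq> 0" using nz by simp
  ultimately show "norm (blaschke_factor a z) = 1"
    unfolding blaschke_factor_def norm_divide by (metis divide_self)
qed

lemma norm_bprod:
  assumes "set_mset zs \<subseteq> ball 0 1" "norm z \<le> 1"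
  shows "norm (bprod zs z) \<le> 1" "norm z = 1 \<Longrightarrow> norm (bprod zs z) = 1"
  using assms(1) norm_blaschke_factor[OF _ assms(2)]
  by (induction zs) (auto simp: norm_mult intro!: mult_le_one)

lemma holomorphic_bprod: "set_mset zs \<subseteq> ball 0 1 \<Longrightarrow> bprod zs holomorphic_on ball 0 1"
  unfolding bprod_eq[abs_def] by (intro holomorphic_intros) (use poly_denom_nonzero in auto)

lemma continuous_bprod: "set_mset zs \<subseteq> ball 0 1 \<Longrightarrow> continuous_on (cball 0 1) (bprod zs)"
  unfolding bprod_eq[abs_def] by (intro continuous_intros) (use poly_denom_nonzero in auto)

lemma poly_low_poly:
  assumes "low_poly n p"
  shows "poly p z = (\<Sum>i<n. coeff p i * z ^ i)"
proof -
  have "(\<Sum>i<n. coeff p i * z ^ i) = (\<Sum>i<max n (Suc (degree p)). coeff p i * z ^ i)"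
    by (rule sum.mono_neutral_left) (use assms in \<open>auto simp: low_poly_def\<close>)
  also have "\<dots> = (\<Sum>i\<le>degree p. coeff p i * z ^ i)"
    by (rule sum.mono_neutral_right) (auto simp: coeff_eq_0)
  finally show ?thesis by (simp add: poly_altdef)
qed

text \<open>On the circle \<open>cnj z * z = 1\<close>, so conjugating \<open>1 - cnj a * z\<close>
  and multiplying by \<open>z\<close> gives \<open>z - a\<close>. The sign comes from the convention
  \<open>a - z\<close> in the Blaschke factor.\<close>

lemma numer_eq_cnj_denom:
  assumes "norm z = 1"
  shows "cnj (poly (denom zs) z) * z ^ size zs = (- 1) ^ size zs * poly (numer zs) z"
proof (induction zs)
  case (add a zs)
  have 1: "cnj z * z = 1" using complex_norm_square[of z] assms by (simp add: mult.commute)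
  have "cnj (1 - cnj a * z) * z = z - a * (cnj z * z)" by (simp add: algebra_simps)
  also have "\<dots> = - (a - z)" by (simp add: 1)
  finally have 2: "cnj (1 - cnj a * z) * z = - (a - z)" .
  have "cnj (poly (denom (add_mset a zs)) z) * z ^ size (add_mset a zs)
     = (cnj (1 - cnj a * z) * z) * (cnj (poly (denom zs) z) * z ^ size zs)"
    by (simp add: algebra_simps)
  also have "\<dots> = (- 1) ^ size (add_mset a zs) * poly (numer (add_mset a zs)) z"
    unfolding 2 add.IH by (simp add: algebra_simps)
  finally show ?case .
qed simp

text \<open>On the circle, conjugating the numerator of \<open>f\<close> and multiplying by
  \<open>z ^ size zs\<close> reverses its coefficients, while the conjugated denominator cancels
  against the numerator of the Blaschke product. The degree bound on \<open>p\<close> leaves only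
  exponents of at least 1, whence \<open>t 0 = 0\<close>.\<close>

lemma rational_space_dual:
  assumes zs: "set_mset zs \<subseteq> ball 0 1" and f: "f \<in> rational_space zs"
  obtains t where "t holomorphic_on ball 0 1" "continuous_on (cball 0 1) t" "t 0 = 0"
    "\<And>z. norm z = 1 \<Longrightarrow> t z = bprod zs z * cnj (eval_fps (h2_fps f) z)"
proof -
  obtain p where p: "low_poly (size zs) p" "h2_fps f * fps_of_poly (denom zs) = fps_of_poly p"
    using f by (auto simp: rational_space_def)
  let ?N = "size zs"
  define t where "t = (\<lambda>z. (- 1) ^ ?N * (\<Sum>i<?N. cnj (coeff p i) * z ^ (?N - i)) / poly (denom zs) z)"
  have "t z = bprod zs z * cnj (eval_fps (h2_fps f) z)" if z: "norm z = 1" for z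
  proof -
    have 1: "z * cnj z = 1" using complex_norm_square[of z] z by simp
    have "z ^ ?N * cnj (poly p z) = (\<Sum>i<?N. z ^ ?N * (cnj (coeff p i) * cnj z ^ i))"
      unfolding poly_low_poly[OF p(1)] by (simp add: sum_distrib_left)
    also have "\<dots> = (\<Sum>i<?N. cnj (coeff p i) * z ^ (?N - i))"
    proof (rule sum.cong)
      fix i assume "i \<in> {..<?N}"
      then have "z ^ ?N = z ^ (?N - i) * z ^ i" by (simp flip: power_add)
      then have "z ^ ?N * cnj z ^ i = z ^ (?N - i) * (z * cnj z) ^ i"
        by (simp add: power_mult_distrib)
      then show "z ^ ?N * (cnj (coeff p i) * cnj z ^ i) = cnj (coeff p i) * z ^ (?N - i)"
        by (simp add: 1 mult.left_commute)
    qed simp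
    finally have t: "t z = (- 1) ^ ?N * (z ^ ?N * cnj (poly p z)) / poly (denom zs) z"
      by (simp add: t_def)
    have d: "poly (denom zs) z \<noteq> 0" by (rule poly_denom_nonzero[OF zs]) (simp add: z)
    have s: "(- 1) ^ ?N * ((- 1) ^ ?N * w) = w" for w :: complex
      by (simp flip: mult.assoc power_mult_distrib)
    have n: "poly (numer zs) z = (- 1) ^ ?N * (cnj (poly (denom zs) z) * z ^ ?N)"
      unfolding numer_eq_cnj_denom[OF z] by (simp add: s)
    have f: "eval_fps (h2_fps f) z = poly p z / poly (denom zs) z"
      by (rule rational_conv_radius(2)[OF zs p(2)]) (simp add: z)
    show ?thesis
      unfolding t bprod_eq n f complex_cnj_divide using d by simp
  qed
  moreover have "t holomorphic_on ball 0 1"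
    unfolding t_def by (intro holomorphic_intros) (use poly_denom_nonzero[OF zs] in auto)
  moreover have "continuous_on (cball 0 1) t"
    unfolding t_def by (intro continuous_intros) (use poly_denom_nonzero[OF zs] in auto)
  moreover have "t 0 = 0" by (auto simp: t_def power_0_left intro!: sum.neutral)
  ultimately show ?thesis using that by blast
qed

lemma conv_radius_gt_1:
  assumes "fps_conv_radius F > 1"
  shows "eval_fps F holomorphic_on ball 0 1" "continuous_on (cball 0 1) (eval_fps F)"
proof -
  have c: "(cball 0 1 :: complex set) \<subseteq> eball 0 (fps_conv_radius F)"
  proof
    fix z :: complex assume "z \<in> cball 0 1"
    then have "ereal (norm z) < fps_conv_radius F"
      by (intro le_less_trans[OF _ assms]) simp
    then show "z \<in> eball 0 (fps_conv_radius F)" by simp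
  qed
  show "continuous_on (cball 0 1) (eval_fps F)"
    by (rule continuous_on_eval_fps[THEN continuous_on_subset, OF c])
  show "eval_fps F holomorphic_on ball 0 1"
    by (rule holomorphic_on_eval_fps) (use c ball_subset_cball in blast)
qed

lemma rational_space_conv_radius:
  assumes "set_mset zs \<subseteq> ball 0 1" "f \<in> rational_space zs"
  shows "fps_conv_radius (h2_fps f) > 1"
  using assms rational_conv_radius(1) by (auto simp: rational_space_def)

lemma conv_radius_h2_fps_diff:
  assumes "fps_conv_radius (h2_fps f) > 1" "fps_conv_radius (h2_fps g) > 1"
  shows "fps_conv_radius (h2_fps (f - g)) > 1"
  unfolding h2_fps_diff
  by (rule less_le_trans[OF _ fps_conv_radius_diff]) (simp add: assms)

lemma eval_h2_fps_diff:
  assumes "fps_conv_radius (h2_fps f) > 1" "fps_conv_radius (h2_fps g) > 1" "norm z \<le> 1"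
  shows "eval_fps (h2_fps (f - g)) z = eval_fps (h2_fps f) z - eval_fps (h2_fps g) z"
proof -
  have "ereal (norm z) \<le> 1" using assms(3) by simp
  with assms(1,2) show ?thesis
    unfolding h2_fps_diff by (intro eval_fps_diff) (rule le_less_trans; assumption)+
qed

text \<open>The circle estimate with the dual functions of \<open>h\<close> and \<open>x\<close> as
  \<open>t\<close> and \<open>w\<close>; Parseval's identity turns its integrals into norms.\<close>

lemma rational_spaces_separated:
  assumes \<delta>: "0 < \<delta>" "\<delta> \<le> 1" and zs: "set_mset zs \<subseteq> ball 0 1" and ws: "set_mset ws \<subseteq> ball 0 1"
    and sep: "\<And>z. norm z < 1 \<Longrightarrow> \<delta> \<le> norm (bprod zs z) \<or> \<delta> \<le> norm (bprod ws z)"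
    and h: "h \<in> rational_space zs" and x: "x \<in> rational_space ws"
  shows "(norm x)\<^sup>2 \<le> (200 * (3 / \<delta>^4)\<^sup>2 + 1/2) * (norm (x - h))\<^sup>2"
proof -
  note ch = rational_space_conv_radius[OF zs h] and cx = rational_space_conv_radius[OF ws x]
  note cy = conv_radius_h2_fps_diff[OF cx ch]
  obtain t where t: "t holomorphic_on ball 0 1" "continuous_on (cball 0 1) t" "t 0 = 0"
    "\<And>z. norm z = 1 \<Longrightarrow> t z = bprod zs z * cnj (eval_fps (h2_fps h) z)"
    using rational_space_dual[OF zs h] by blast
  obtain w where w: "w holomorphic_on ball 0 1" "continuous_on (cball 0 1) w" "w 0 = 0"
    "\<And>z. norm z = 1 \<Longrightarrow> w z = bprod ws z * cnj (eval_fps (h2_fps x) z)"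
    using rational_space_dual[OF ws x] by blast
  have "integral {0..2*pi} (\<lambda>s. (norm (eval_fps (h2_fps x) (cis s)))\<^sup>2)
    \<le> (200 * (3 / \<delta>^4)\<^sup>2 + 1/2) * integral {0..2*pi} (\<lambda>s. (norm (eval_fps (h2_fps (x - h)) (cis s)))\<^sup>2)"
  proof (rule corona_circle_estimate[OF \<delta> holomorphic_bprod[OF zs] holomorphic_bprod[OF ws] conv_radius_gt_1(1)[OF cx]
        t(1) w(1) continuous_bprod[OF zs] continuous_bprod[OF ws] conv_radius_gt_1(2)[OF cx] t(2) w(2) _ _ _ _ _ _ _ _ t(3) w(3)])
    show "continuous_on (sphere 0 1) (eval_fps (h2_fps (x - h)))"
      by (rule continuous_on_subset[OF conv_radius_gt_1(2)[OF cy]]) auto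
    show "\<delta>\<^sup>2 \<le> (norm (bprod zs z))\<^sup>2 + (norm (bprod ws z))\<^sup>2" if "z \<in> ball 0 1" for z
    proof -
      have "\<delta>\<^sup>2 \<le> (norm (bprod zs z))\<^sup>2 \<or> \<delta>\<^sup>2 \<le> (norm (bprod ws z))\<^sup>2"
        using sep[of z] that \<delta> by (auto intro: power_mono)
      then show ?thesis by (smt (verit) zero_le_power2)
    qed
  qed (use norm_bprod[OF zs] norm_bprod[OF ws] w(4) in \<open>auto simp: t(4) eval_h2_fps_diff[OF cx ch]\<close>)
  then have "2 * pi * (norm x)\<^sup>2 \<le> (200 * (3 / \<delta>^4)\<^sup>2 + 1/2) * (2 * pi * (norm (x - h))\<^sup>2)"
    unfolding norm_h2_circle[OF cx] norm_h2_circle[OF cy] .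
  also have "\<dots> = 2 * pi * ((200 * (3 / \<delta>^4)\<^sup>2 + 1/2) * (norm (x - h))\<^sup>2)" by simp
  finally show ?thesis by simp
qed

section \<open>Reproducing kernels of the model spaces\<close>

lemma norm_h2_mono_circle:
  assumes "fps_conv_radius (h2_fps f) > 1" "fps_conv_radius (h2_fps g) > 1" "0 \<le> c" "0 \<le> d"
    and le: "\<And>z. norm z = 1 \<Longrightarrow> c * norm (eval_fps (h2_fps f) z) \<le> d * norm (eval_fps (h2_fps g) z)"
  shows "c * norm f \<le> d * norm g"
proof -
  have i: "(\<lambda>s. a\<^sup>2 * (norm (eval_fps (h2_fps f) (cis s)))\<^sup>2) integrable_on {0..2*pi}"
    if "fps_conv_radius (h2_fps f) > 1" for f and a :: real
    by (intro integrable_continuous_real continuous_intros continuous_on_compose2[OF conv_radius_gt_1(2)[OF that]]) auto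
  have "c\<^sup>2 * (2 * pi * (norm f)\<^sup>2) \<le> d\<^sup>2 * (2 * pi * (norm g)\<^sup>2)"
    unfolding norm_h2_circle[OF assms(1)] norm_h2_circle[OF assms(2)] integral_mult_right[symmetric]
  proof (rule integral_le[OF i[OF assms(1)] i[OF assms(2)]])
    fix s
    have "(c * norm (eval_fps (h2_fps f) (cis s)))\<^sup>2 \<le> (d * norm (eval_fps (h2_fps g) (cis s)))\<^sup>2"
      using assms(3) by (intro power_mono le) auto
    then show "c\<^sup>2 * (norm (eval_fps (h2_fps f) (cis s)))\<^sup>2 \<le> d\<^sup>2 * (norm (eval_fps (h2_fps g) (cis s)))\<^sup>2"
      by (simp add: power_mult_distrib)
  qed
  then have "2 * pi * (c * norm f)\<^sup>2 \<le> 2 * pi * (d * norm g)\<^sup>2"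
    by (simp add: power_mult_distrib mult_ac)
  then have "(c * norm f)\<^sup>2 \<le> (d * norm g)\<^sup>2" by simp
  then show ?thesis by (rule power2_le_imp_le) (use assms(4) in simp)
qed

text \<open>For \<open>a = 0\<close> the factor \<open>1 - cnj a * z\<close> has no root at which
  divisibility could be tested, so the quotient is built by induction over the zeros, uniformly in
  \<open>a\<close>.\<close>

lemma kernel_poly:
  assumes "norm a < 1" "set_mset zs \<subseteq> ball 0 1"
  shows "\<exists>p. low_poly (size zs) p \<and>
    denom zs - Polynomial.smult (cnj (bprod zs a)) (numer zs) = [:1, - cnj a:] * p"
  using assms(2)
proof (induction zs)
  case empty
  then show ?case by (intro exI[of _ 0]) (simp add: low_poly_def)
next
  case (add c zs)
  then obtain p where p: "low_poly (size zs) p"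
    "denom zs - Polynomial.smult (cnj (bprod zs a)) (numer zs) = [:1, - cnj a:] * p" by auto
  have nz: "1 - c * cnj a \<noteq> 0"
    using poly_denom_nonzero[of "{#c#}" a] add.prems assms(1) by (auto simp: complex_eq_iff algebra_simps)
  define \<beta> where "\<beta> = cnj (blaschke_factor c a)"
  define \<kappa> where "\<kappa> = (1 - c * cnj c) / (1 - c * cnj a)"
  have \<beta>: "\<beta> = (cnj c - cnj a) / (1 - c * cnj a)" by (simp add: \<beta>_def blaschke_factor_def)
  define r where "r = Polynomial.smult \<kappa> (denom zs) + Polynomial.smult \<beta> ([:c, - 1:] * p)"
  \<comment> \<open>The case of a single zero \<open>c\<close>: its kernel at \<open>a\<close> is
    \<kappa>\<open>/ (1 - cnj c * z)\<close>.\<close>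
  have e: "[:1, - cnj c:] - Polynomial.smult \<beta> [:c, - 1:] = Polynomial.smult \<kappa> [:1, - cnj a:]"
    using nz by (simp add: \<beta> \<kappa>_def field_simps)
  have "low_poly (size (add_mset c zs)) r"
  proof -
    have "low_poly (size zs + 1) (p * [:c, - 1:])"
      by (rule low_poly_mult[OF p(1)]) (simp add: low_poly_def coeff_pCons split: nat.splits)
    then show ?thesis
      unfolding r_def by (intro low_poly_add low_poly_smult) (simp_all add: mult.commute low_poly_denom del: mult_pCons_left mult_pCons_right)
  qed
  moreover have "denom (add_mset c zs) - Polynomial.smult (cnj (bprod (add_mset c zs) a)) (numer (add_mset c zs))
     = [:1, - cnj a:] * r"
  proof -
    have "denom (add_mset c zs) - Polynomial.smult (cnj (bprod (add_mset c zs) a)) (numer (add_mset c zs))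
      = [:1, - cnj c:] * denom zs - (Polynomial.smult \<beta> [:c, - 1:]) * (Polynomial.smult (cnj (bprod zs a)) (numer zs))"
      by (simp only: denom_simps numer_simps bprod_simps complex_cnj_mult \<beta>_def[symmetric] mult_smult_left mult_smult_right smult_smult mult_ac)
    also have "Polynomial.smult (cnj (bprod zs a)) (numer zs) = denom zs - [:1, - cnj a:] * p"
      using p(2) by (simp add: algebra_simps del: mult_pCons_left mult_pCons_right)
    also have "[:1, - cnj c:] * denom zs - (Polynomial.smult \<beta> [:c, - 1:]) * (denom zs - [:1, - cnj a:] * p)
      = ([:1, - cnj c:] - Polynomial.smult \<beta> [:c, - 1:]) * denom zs + [:1, - cnj a:] * (Polynomial.smult \<beta> [:c, - 1:] * p)"
      by (simp only: algebra_simps)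
    also have "\<dots> = [:1, - cnj a:] * r"
      unfolding e r_def by (simp only: mult_smult_left mult_smult_right distrib_left)
    finally show ?thesis .
  qed
  ultimately show ?case by blast
qed

lemma rational_kernel:
  assumes a: "norm a < 1" and zs: "set_mset zs \<subseteq> ball 0 1"
  obtains x where "x \<in> rational_space zs"
    "\<And>z. norm z \<le> 1 \<Longrightarrow> eval_fps (h2_fps x) z = (1 - cnj (bprod zs a) * bprod zs z) / (1 - cnj a * z)"
proof -
  obtain p where p: "low_poly (size zs) p"
    "denom zs - Polynomial.smult (cnj (bprod zs a)) (numer zs) = [:1, - cnj a:] * p"
    using kernel_poly[OF a zs] by blast
  obtain x where x: "x \<in> rational_space zs" "h2_fps x * fps_of_poly (denom zs) = fps_of_poly p"
    using rational_space_element[OF zs p(1)] by blast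
  have "eval_fps (h2_fps x) z = (1 - cnj (bprod zs a) * bprod zs z) / (1 - cnj a * z)" if z: "norm z \<le> 1" for z
  proof -
    have d: "poly (denom zs) z \<noteq> 0" by (rule poly_denom_nonzero[OF zs z])
    have d1: "1 - cnj a * z \<noteq> 0"
      using poly_denom_nonzero[of "{#a#}" z] z a by (simp add: mult.commute)
    have "poly (denom zs) z - cnj (bprod zs a) * poly (numer zs) z = (1 - cnj a * z) * poly p z"
      using arg_cong[OF p(2), of "\<lambda>p. poly p z"] by (simp add: algebra_simps)
    then have "poly p z = (poly (denom zs) z - cnj (bprod zs a) * poly (numer zs) z) / (1 - cnj a * z)"
      using d1 by (simp add: field_simps)
    moreover have "eval_fps (h2_fps x) z = poly p z / poly (denom zs) z"
      by (rule rational_conv_radius(2)[OF zs x(2) z])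
    ultimately show ?thesis
      unfolding bprod_eq[of zs z] using d by (simp add: diff_divide_distrib mult.commute)
  qed
  then show ?thesis using x that by blast
qed

text \<open>
  \<open>x\<close> and \<open>h\<close> are the projections of the reproducing kernel at \<open>a\<close> onto the two model spaces,
  and \<open>k\<close> is the norm of that kernel.
\<close>

lemma kernel_estimate:
  assumes a: "norm a < 1" and zs: "set_mset zs \<subseteq> ball 0 1" and ws: "set_mset ws \<subseteq> ball 0 1"
  obtains x h k where "x \<in> rational_space ws" "h \<in> rational_space zs" "k > 0"
    "(1 - norm (bprod ws a)) * k \<le> norm x"
    "norm (x - h) \<le> (norm (bprod zs a) + norm (bprod ws a)) * k"
proof -
  obtain x where x: "x \<in> rational_space ws"
    "\<And>z. norm z \<le> 1 \<Longrightarrow> eval_fps (h2_fps x) z = (1 - cnj (bprod ws a) * bprod ws z) / (1 - cnj a * z)"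
    using rational_kernel[OF a ws] by blast
  obtain h where h: "h \<in> rational_space zs"
    "\<And>z. norm z \<le> 1 \<Longrightarrow> eval_fps (h2_fps h) z = (1 - cnj (bprod zs a) * bprod zs z) / (1 - cnj a * z)"
    using rational_kernel[OF a zs] by blast
  have s: "set_mset {#a#} \<subseteq> ball 0 1" using a by simp
  \<comment> \<open>The kernel at \<open>a\<close> of the space with the single zero
    \<open>a\<close> is the kernel \<open>1 / (1 - cnj a * z)\<close> of the whole Hardy space,
    because its Blaschke product vanishes at \<open>a\<close>.\<close>
  have "bprod {#a#} a = 0" by (simp add: blaschke_factor_def flip: bprod_simps(1))
  then obtain k where k: "k \<in> rational_space {#a#}" "\<And>z. norm z \<le> 1 \<Longrightarrow> eval_fps (h2_fps k) z = 1 / (1 - cnj a * z)"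
    using rational_kernel[OF a s] by (metis (no_types, lifting) complex_cnj_zero diff_zero mult_zero_left)
  note cx = rational_space_conv_radius[OF ws x(1)] and ch = rational_space_conv_radius[OF zs h(1)]
    and ck = rational_space_conv_radius[OF s k(1)]
  have "k \<noteq> 0"
    using k(2)[of 0] by (auto simp: h2_fps_zero)
  moreover have "(1 - norm (bprod ws a)) * norm k \<le> 1 * norm x"
  proof (rule norm_h2_mono_circle[OF ck cx])
    show "0 \<le> 1 - norm (bprod ws a)" using norm_bprod(1)[OF ws, of a] a by simp
    fix z :: complex assume z: "norm z = 1"
    have "1 - norm (bprod ws a) \<le> norm (1 - cnj (bprod ws a) * bprod ws z)"
      using norm_triangle_ineq2[of 1 "cnj (bprod ws a) * bprod ws z"] norm_bprod(2)[OF ws _ z] z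
      by (simp add: norm_mult)
    then show "(1 - norm (bprod ws a)) * norm (eval_fps (h2_fps k) z) \<le> 1 * norm (eval_fps (h2_fps x) z)"
      using z by (simp add: k(2) x(2) norm_divide divide_right_mono)
  qed simp
  moreover have "1 * norm (x - h) \<le> (norm (bprod zs a) + norm (bprod ws a)) * norm k"
  proof (rule norm_h2_mono_circle[OF conv_radius_h2_fps_diff[OF cx ch] ck])
    fix z :: complex assume z: "norm z = 1"
    \<comment> \<open>The constants 1 in the two kernels cancel, leaving only terms of modulus
      \<open>|B(a)|\<close> and \<open>|C(a)|\<close> over the common denominator.\<close>
    have "eval_fps (h2_fps (x - h)) z = (cnj (bprod zs a) * bprod zs z - cnj (bprod ws a) * bprod ws z) / (1 - cnj a * z)"
      using z by (simp add: eval_h2_fps_diff[OF cx ch] x(2) h(2) flip: diff_divide_distrib)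
    moreover have "norm (cnj (bprod zs a) * bprod zs z - cnj (bprod ws a) * bprod ws z) \<le> norm (bprod zs a) + norm (bprod ws a)"
      using norm_triangle_ineq4[of "cnj (bprod zs a) * bprod zs z" "cnj (bprod ws a) * bprod ws z"]
        norm_bprod(2)[OF ws _ z] norm_bprod(2)[OF zs _ z] z by (simp add: norm_mult)
    ultimately show "1 * norm (eval_fps (h2_fps (x - h)) z) \<le> (norm (bprod zs a) + norm (bprod ws a)) * norm (eval_fps (h2_fps k) z)"
      using z by (simp add: k(2) norm_divide divide_right_mono)
  qed simp_all
  ultimately show ?thesis using x h that[of x h "norm k"] by simp
qed

section \<open>Spans of model spaces\<close>

lemma denom_replicate: "denom (replicate_mset n c) = [:1, - cnj c:] ^ n"
  by (induction n) simp_all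

lemma coeff_denom_size: "0 \<notin># zs \<Longrightarrow> coeff (denom zs) (size zs) \<noteq> 0"
proof (induction zs)
  case (add a zs)
  have "coeff (denom (add_mset a zs)) (size (add_mset a zs)) = coeff (denom zs) (Suc (size zs)) - cnj a * coeff (denom zs) (size zs)"
    by simp
  then show ?case using add coeff_denom[of zs "Suc (size zs)"] by auto
qed simp

lemma low_poly_linear_cancel:
  assumes "low_poly (Suc n) ([:b, c:] * p)" "c \<noteq> 0"
  shows "low_poly n p"
proof (cases "p = 0")
  case False
  have "degree ([:b, c:] * p) = Suc (degree p)"
    using False assms(2) by (subst degree_mult_eq) auto
  then have "coeff ([:b, c:] * p) (Suc (degree p)) \<noteq> 0"
    using False assms(2) by (metis leading_coeff_0_iff mult_eq_0_iff pCons_eq_0_iff)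
  then have "Suc (degree p) < Suc n"
    using assms(1) unfolding low_poly_def by (meson not_le_imp_less)
  then show ?thesis by (auto simp: low_poly_def coeff_eq_0)
qed (simp add: low_poly_def)

text \<open>
  For \<open>c \<noteq> 0\<close> the coefficient \<open>\<alpha>\<close> of the new partial fraction is read off at the pole \<open>1 / cnj c\<close>;
  for \<open>c = 0\<close> the pole is at infinity and \<open>\<alpha>\<close> is read off from the top coefficients.
\<close>

lemma partial_fraction_step:
  assumes c: "c \<notin># ws" and p: "low_poly (Suc (m + size ws)) p"
  obtains q p' where "low_poly (Suc m) q" "p - q * denom ws = [:1, - cnj c:] * p'"
    "low_poly (m + size ws) p'"
proof (cases "c = 0")
  case True
  define \<alpha> where "\<alpha> = coeff p (m + size ws) / coeff (denom ws) (size ws)"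
  define p' where "p' = p - monom \<alpha> m * denom ws"
  have "low_poly (m + size ws) p'"
    unfolding low_poly_def
  proof (intro allI impI)
    fix i assume "i \<ge> m + size ws"
    then consider "i = m + size ws" | "i \<ge> Suc (m + size ws)" by linarith
    then show "coeff p' i = 0"
    proof cases
      case 1
      then show ?thesis
        using coeff_denom_size[of ws] c True by (simp add: p'_def \<alpha>_def coeff_monom_mult)
    next
      case 2
      then show ?thesis
        using p coeff_denom[of ws "i - m"] by (simp add: p'_def coeff_monom_mult low_poly_def)
    qed
  qed
  moreover have "low_poly (Suc m) (monom \<alpha> m)" by (auto simp: low_poly_def)
  moreover have "p - monom \<alpha> m * denom ws = [:1, - cnj c:] * p'" by (simp add: True p'_def)
  ultimately show ?thesis using that by blast
next
  case False
  define v where "v = 1 / cnj c"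
  define \<alpha> where "\<alpha> = poly p v / poly (denom ws) v"
  have "poly (denom ws) v \<noteq> 0"
    using c
  proof (induction ws)
    case (add a ws)
    then have "1 - cnj a * v \<noteq> 0" using False by (auto simp: v_def field_simps)
    then show ?case using add by (simp add: mult.commute)
  qed simp
  then have "poly (p - [:\<alpha>:] * denom ws) v = 0" by (simp add: \<alpha>_def)
  then obtain r where r: "p - [:\<alpha>:] * denom ws = [:- v, 1:] * r"
    using poly_eq_0_iff_dvd by (metis dvdE)
  define p' where "p' = Polynomial.smult (- v) r"
  have "[:1, - cnj c:] * p' = Polynomial.smult (- v) [:1, - cnj c:] * r"
    unfolding p'_def by (simp only: mult_smult_left mult_smult_right)
  also have "Polynomial.smult (- v) [:1, - cnj c:] = [:- v, 1:]" using False by (simp add: v_def)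
  finally have e: "p - [:\<alpha>:] * denom ws = [:1, - cnj c:] * p'" using r by simp
  have "low_poly (Suc (m + size ws)) (p - [:\<alpha>:] * denom ws)"
    using p coeff_denom[of ws] by (simp add: low_poly_def)
  then have "low_poly (m + size ws) p'"
    unfolding e by (rule low_poly_linear_cancel) (use False in simp)
  moreover have "low_poly (Suc m) [:\<alpha>:]" by (auto simp: low_poly_def coeff_pCons split: nat.splits)
  ultimately show ?thesis using e that by blast
qed

text \<open>Partial fractions by induction over the zeros. The new zero \<open>c\<close> raises its
  multiplicity to \<open>Suc m\<close>; the highest-order term at its pole belongs to the space with
  \<open>c\<close> alone as zero, and the remainder has one zero fewer.\<close>

lemma rational_space_subset_subspace:
  assumes M: "h2.subspace M" and zs: "set_mset zs \<subseteq> ball 0 1"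
    and sub: "\<And>c. c \<in># zs \<Longrightarrow> rational_space (replicate_mset (count zs c) c) \<subseteq> M"
  shows "rational_space zs \<subseteq> M"
  using zs sub
proof (induction zs)
  case empty
  have "f = 0" if f: "f \<in> rational_space {#}" for f
  proof -
    obtain p where "low_poly 0 p" "h2_fps f = fps_of_poly p" using f by (auto simp: rational_space_def)
    then have "h2_fps f = h2_fps 0" by (simp add: low_poly_def poly_eq_iff h2_fps_zero)
    then show ?thesis by (rule h2_fps_inject)
  qed
  then show ?case using h2.subspace_0[OF M] by blast
next
  case (add c zs)
  have IH: "rational_space zs \<subseteq> M"
  proof (rule add.IH)
    fix d assume d: "d \<in># zs"
    have "replicate_mset (count zs d) d \<subseteq># replicate_mset (count (add_mset c zs) d) d"
      by (auto simp: subseteq_mset_def)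
    from rational_space_mono[OF this] show "rational_space (replicate_mset (count zs d) d) \<subseteq> M"
      using add.prems(2)[of d] d by auto
  qed (use add.prems in auto)
  define m where "m = count zs c"
  define ws where "ws = filter_mset (\<lambda>x. x \<noteq> c) zs"
  have zs: "zs = replicate_mset m c + ws"
    unfolding m_def ws_def by (rule multiset_eqI) auto
  have cws: "c \<notin># ws" by (simp add: ws_def)
  have N: "size zs = m + size ws" by (simp add: zs)
  let ?L = "[:1, - cnj c:]"
  have dz: "denom zs = ?L ^ m * denom ws" by (simp add: zs denom_replicate)
  show ?case
  proof
    fix f assume "f \<in> rational_space (add_mset c zs)"
    then obtain p where p: "low_poly (Suc (m + size ws)) p"
      "h2_fps f * fps_of_poly (denom (add_mset c zs)) = fps_of_poly p"
      by (auto simp: rational_space_def N simp del: denom_simps)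
    obtain q p' where q: "low_poly (Suc m) q" "p - q * denom ws = ?L * p'" "low_poly (m + size ws) p'"
      using partial_fraction_step[OF cws p(1)] .
    have cb: "set_mset (replicate_mset (Suc m) c) \<subseteq> ball 0 1" using add.prems(1) by simp
    obtain e where e: "e \<in> rational_space (replicate_mset (Suc m) c)"
      "h2_fps e * fps_of_poly (denom (replicate_mset (Suc m) c)) = fps_of_poly q"
      using rational_space_element[OF cb, of q] q(1) by auto
    have eM: "e \<in> M"
      using e(1) add.prems(2)[of c] by (auto simp: m_def)
    have "(h2_fps (f - e) * fps_of_poly (denom zs)) * fps_of_poly ?L
       = h2_fps f * fps_of_poly (denom (add_mset c zs)) - (h2_fps e * fps_of_poly (denom (replicate_mset (Suc m) c))) * fps_of_poly (denom ws)"
      unfolding dz denom_simps denom_replicate h2_fps_diff fps_of_poly_mult power_Suc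
      by (simp only: algebra_simps)
    also have "\<dots> = fps_of_poly (p - q * denom ws)"
      unfolding p(2) e(2) by (simp only: fps_of_poly_diff fps_of_poly_mult)
    also have "\<dots> = fps_of_poly p' * fps_of_poly ?L"
      unfolding q(2) fps_of_poly_mult by (simp only: mult.commute)
    finally have "h2_fps (f - e) * fps_of_poly (denom zs) = fps_of_poly p'"
      using fps_of_poly_eq_iff[of ?L 0] by (simp only: mult_cancel_right fps_of_poly_0) simp
    then have "f - e \<in> rational_space zs"
      using q(3) by (auto simp: rational_space_def N)
    then have "(f - e) + e \<in> M" using IH eM h2.subspace_add[OF M] by blast
    then show "f \<in> M" by simp
  qed
qed

lemma bprod_replicate: "bprod (replicate_mset n c) z = blaschke_factor c z ^ n"
  by (induction n) simp_all

lemma bprod_sum: "finite K \<Longrightarrow> bprod (\<Sum>k\<in>K. Z k) z = (\<Prod>k\<in>K. bprod (Z k) z)"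
  by (induction K rule: finite_induct) simp_all

section \<open>Sequences of Blaschke products\<close>

text \<open>Positive dimension yields a Jordan block of positive size, so some eigenvalue has
  positive order and the multiset is not empty.\<close>

lemma blaschke_mat_eq_bprod:
  assumes "square_mat M" "0 < dim_row M"
  obtains zs where "set_mset zs \<subseteq> spectrum M" "zs \<noteq> {#}" "blaschke_mat M = bprod zs"
proof -
  define n where "n = dim_row M"
  have M: "M \<in> carrier_mat n n" using assms(1) by (auto simp: n_def)
  define zs where "zs = (\<Sum>\<mu>\<in>spectrum M. replicate_mset (eigenvalue_order M \<mu>) \<mu>)"
  have fin: "finite (spectrum M)" by (rule card_finite_spectrum(1)[OF M])
  have bm: "blaschke_mat M = bprod zs"
    by (rule ext) (simp add: blaschke_mat_def zs_def bprod_sum[OF fin] bprod_replicate)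
  have mem: "x \<in># zs \<longleftrightarrow> x \<in> spectrum M \<and> eigenvalue_order M x \<noteq> 0" for x
    unfolding zs_def using fin by (simp add: set_mset_sum)
  obtain as where "char_poly M = (\<Prod>a\<leftarrow>as. [:- a, 1:])"
    using char_poly_factorized[OF M] by blast
  from jordan_nf_exists[OF M this] obtain n_as where jnf: "jordan_nf M n_as" by blast
  have "n_as \<noteq> []"
    using jordan_nf_char_poly[OF jnf] degree_monic_char_poly[OF M] assms(2) by (auto simp: n_def)
  then obtain m \<mu> rest where n_as: "n_as = (m, \<mu>) # rest" by (metis list.exhaust surj_pair)
  have m: "m \<noteq> 0" using jnf by (auto simp: jordan_nf_def n_as)
  have "poly (char_poly M) \<mu> = 0"
    unfolding jordan_nf_char_poly[OF jnf] n_as using m by simp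
  then have \<mu>: "\<mu> \<in> spectrum M" by (simp add: spectrum_root_char_poly[OF M])
  define S where "S = {m. \<exists>n_as. jordan_nf M n_as \<and> (m, \<mu>) \<in> set n_as}"
  \<comment> \<open>\<open>Max\<close> is meaningful only on a finite nonempty set; block sizes are
    bounded by the algebraic multiplicity of the eigenvalue.\<close>
  have "finite S"
    by (rule finite_subset[of _ "{..order \<mu> (char_poly M)}"])
      (use jordan_nf_block_size_order_bound in \<open>auto simp: S_def\<close>)
  moreover have "m \<in> S" using jnf by (auto simp: S_def n_as)
  ultimately have "m \<le> eigenvalue_order M \<mu>" by (simp add: eigenvalue_order_def S_def)
  then have "\<mu> \<in># zs" using m \<mu> mem by auto
  then have "zs \<noteq> {#}" by auto
  moreover have "set_mset zs \<subseteq> spectrum M" using mem by auto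
  ultimately show ?thesis using bm that[of zs] by simp
qed

text \<open>The partial products decrease and are nonnegative, so the \<open>lim\<close> in the
  definition is a genuine limit.\<close>

lemma prod_except_bounds:
  assumes a: "\<And>k. 0 \<le> a k" "\<And>k. a k \<le> 1"
  shows "prod_except n a \<le> (\<Prod>k\<in>{..<N} - {n}. a k)"
    and "(\<And>N. c \<le> (\<Prod>k\<in>{..<N} - {n}. a k)) \<Longrightarrow> c \<le> prod_except n a"
proof -
  define P where "P = (\<lambda>N. \<Prod>k\<in>{..<N} - {n}. a k)"
  have "P (Suc N) \<le> P N" for N
  proof (cases "N = n")
    case False
    then have "{..<Suc N} - {n} = insert N ({..<N} - {n})" by auto
    then have "P (Suc N) = a N * P N" by (simp add: P_def)
    then show ?thesis using a by (simp add: P_def mult_left_le_one_le prod_nonneg)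
  next
    case True
    then have "{..<Suc N} - {n} = {..<N} - {n}" by auto
    then show ?thesis by (simp add: P_def)
  qed
  then have dec: "decseq P" by (simp add: decseq_Suc_iff)
  have "0 \<le> P N" for N using a by (simp add: P_def prod_nonneg)
  then have "\<forall>i. 0 \<le> P i" by blast
  with dec obtain L where "P \<longlonglongrightarrow> L" by (rule decseq_convergent)
  then have L: "P \<longlonglongrightarrow> prod_except n a"
    unfolding prod_except_def P_def[symmetric] by (simp add: limI)
  show "prod_except n a \<le> (\<Prod>k\<in>{..<N} - {n}. a k)"
    using decseq_ge[OF dec L, of N] by (simp add: P_def)
  show "c \<le> prod_except n a" if "\<And>N. c \<le> (\<Prod>k\<in>{..<N} - {n}. a k)"
    by (rule LIMSEQ_le_const[OF L]) (use that in \<open>auto simp: P_def\<close>)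
qed

text \<open>\<open>Z n\<close> holds the zeros of the \<open>n\<close>-th Blaschke product.
  Nonemptiness makes every model space nonzero, so the infimum in \<open>subspace_sin\<close> has
  unit vectors to range over.\<close>

locale blaschke_sequence =
  fixes Z :: "nat \<Rightarrow> complex multiset"
  assumes in_ball: "set_mset (Z n) \<subseteq> ball 0 1" and nonempty: "Z n \<noteq> {#}"
begin

definition W :: "nat \<Rightarrow> nat \<Rightarrow> complex multiset" where
  "W n N = (\<Sum>k\<in>{..<N} - {n}. Z k)"

definition H :: "nat \<Rightarrow> hardy2 set" where
  "H n = rational_space (Z n)"

definition others :: "nat \<Rightarrow> hardy2 set" where
  "others n = h2.span (\<Union>j\<in>- {n}. H j)"

definition pe :: "nat \<Rightarrow> complex \<Rightarrow> real" where
  "pe n z = prod_except n (\<lambda>k. norm (bprod (Z k) z))"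

section \<open>Partial products and their spaces\<close>

lemma W_in_ball: "set_mset (W n N) \<subseteq> ball 0 1"
  using in_ball by (auto simp: W_def set_mset_sum)

lemma norm_bprod_W: "norm (bprod (W n N) z) = (\<Prod>k\<in>{..<N} - {n}. norm (bprod (Z k) z))"
  by (simp add: W_def bprod_sum prod_norm)

lemma pe_le: "norm z < 1 \<Longrightarrow> pe n z \<le> norm (bprod (W n N) z)"
  unfolding pe_def norm_bprod_W
  by (rule prod_except_bounds(1)) (use norm_bprod(1)[OF in_ball] in auto)

lemma pe_ge: "norm z < 1 \<Longrightarrow> (\<And>N. c \<le> norm (bprod (W n N) z)) \<Longrightarrow> c \<le> pe n z"
  unfolding pe_def norm_bprod_W
  by (rule prod_except_bounds(2)) (use norm_bprod(1)[OF in_ball] in auto)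

lemma pe_bounds: "norm z < 1 \<Longrightarrow> 0 \<le> pe n z" "norm z < 1 \<Longrightarrow> pe n z \<le> 1"
  using pe_ge[of z 0 n] pe_le[of z n 0] by (auto simp: W_def)

text \<open>\<open>Suc n\<close> is the first truncation that contains the factor with index
  \<open>n\<close>; the other factors have modulus at most 1.\<close>

lemma norm_W_le:
  assumes "m \<noteq> n" "norm z < 1"
  shows "norm (bprod (W m (Suc n)) z) \<le> norm (bprod (Z n) z)"
proof -
  have "{..<Suc n} - {m} = insert n ({..<n} - {m})" using assms(1) by auto
  then have "norm (bprod (W m (Suc n)) z) = norm (bprod (Z n) z) * (\<Prod>k\<in>{..<n} - {m}. norm (bprod (Z k) z))"
    unfolding norm_bprod_W by simp
  also have "\<dots> \<le> norm (bprod (Z n) z)"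
    using norm_bprod(1)[OF in_ball] assms(2) by (intro mult_left_le prod_le_1) auto
  finally show ?thesis .
qed

text \<open>The spaces of the partial products increase, so their union is a subspace. Each vector
  of the algebraic span thus lies in the space of one finite product, where the estimate for two
  spaces applies.\<close>

lemma others_subset: "others n \<subseteq> (\<Union>N. rational_space (W n N))"
  unfolding others_def
proof (rule h2.span_minimal)
  show "(\<Union>j\<in>- {n}. H j) \<subseteq> (\<Union>N. rational_space (W n N))"
  proof (rule UN_least)
    fix j assume "j \<in> - {n}"
    then have "{..<Suc j} - {n} = insert j ({..<j} - {n})" by auto
    then have "W n (Suc j) = Z j + W n j" by (simp add: W_def)
    then have "rational_space (Z j) \<subseteq> rational_space (W n (Suc j))"
      by (intro rational_space_mono) simp
    then show "H j \<subseteq> (\<Union>N. rational_space (W n N))"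
      unfolding H_def by blast
  qed
  have mono: "rational_space (W n N) \<subseteq> rational_space (W n N')" if "N \<le> N'" for N N'
  proof (rule rational_space_mono)
    have "W n N' = (\<Sum>k\<in>({..<N'} - {n}) - ({..<N} - {n}). Z k) + W n N"
      unfolding W_def by (rule sum.subset_diff) (use that in auto)
    then show "W n N \<subseteq># W n N'" by simp
  qed
  show "h2.subspace (\<Union>N. rational_space (W n N))"
    unfolding h2.subspace_def
  proof (intro conjI ballI allI)
    show "0 \<in> (\<Union>N. rational_space (W n N))"
      using h2.subspace_0[OF subspace_rational_space] by blast
    fix x assume x: "x \<in> (\<Union>N. rational_space (W n N))"
    then show "scaleC_h2 c x \<in> (\<Union>N. rational_space (W n N))" for c
      using h2.subspace_scale[OF subspace_rational_space] by blast
    fix y assume "y \<in> (\<Union>N. rational_space (W n N))"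
    then obtain N N' where "x \<in> rational_space (W n N)" "y \<in> rational_space (W n N')" using x by blast
    then have "x \<in> rational_space (W n (max N N'))" "y \<in> rational_space (W n (max N N'))"
      using mono[of N "max N N'"] mono[of N' "max N N'"] by auto
    then show "x + y \<in> (\<Union>N. rational_space (W n N))"
      using h2.subspace_add[OF subspace_rational_space] by blast
  qed
qed

lemma unit_in_others: "\<exists>k\<in>closure (others n). norm k = 1"
proof -
  obtain f where f: "f \<in> H (Suc n)" "norm f = 1"
    using rational_space_unit_vector[OF in_ball nonempty] unfolding H_def by blast
  then have "f \<in> others n" unfolding others_def by (intro h2.span_base) auto
  then show ?thesis using f(2) closure_subset by blast
qed

lemma zero_in_H: "0 \<in> H n"
  unfolding H_def by (rule h2.subspace_0[OF subspace_rational_space])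

lemma subspace_sin_nonneg: "0 \<le> subspace_sin (H n) (closure (others n))"
  unfolding subspace_sin_def
  by (rule cINF_greatest) (use unit_in_others in \<open>auto simp: infdist_nonneg\<close>)

lemma subspace_sin_le:
  assumes "x \<in> others n" "h \<in> H n"
  shows "subspace_sin (H n) (closure (others n)) * norm x \<le> norm (x - h)"
proof (cases "x = 0")
  case False
  define r where "r = 1 / norm x"
  have r: "r > 0" using False by (simp add: r_def)
  have "r *\<^sub>R x \<in> others n"
    using assms(1) unfolding others_def scaleR_hardy2_def by (rule h2.span_scale)
  then have "r *\<^sub>R x \<in> {k \<in> closure (others n). norm k = 1}"
    using closure_subset False by (auto simp: r_def)
  then have "subspace_sin (H n) (closure (others n)) \<le> infdist (r *\<^sub>R x) (H n)"
    unfolding subspace_sin_def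
    by (intro cINF_lower bdd_belowI[of _ 0]) (auto simp: infdist_nonneg)
  also have "\<dots> \<le> dist (r *\<^sub>R x) (r *\<^sub>R h)"
    using scaleR_rational_space assms(2) unfolding H_def by (intro infdist_le) auto
  also have "\<dots> = r * norm (x - h)"
    using r by (simp add: dist_norm flip: scaleR_diff_right)
  finally show ?thesis using False by (simp add: r_def field_simps)
qed simp

text \<open>The bound on \<open>infdist\<close> is a closed condition on \<open>x\<close>, so it
  passes from the algebraic span to its closure.\<close>

lemma subspace_sin_ge:
  assumes "\<And>x h. x \<in> others n \<Longrightarrow> h \<in> H n \<Longrightarrow> c * norm x \<le> norm (x - h)"
  shows "c \<le> subspace_sin (H n) (closure (others n))"
  unfolding subspace_sin_def
proof (rule cINF_greatest)
  have "closed {x. c * norm x \<le> infdist x (H n)}"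
    by (intro closed_Collect_le continuous_intros)
  moreover have "others n \<subseteq> {x. c * norm x \<le> infdist x (H n)}"
    unfolding infdist_def using zero_in_H assms by (auto simp: dist_norm intro!: cINF_greatest)
  ultimately have "closure (others n) \<subseteq> {x. c * norm x \<le> infdist x (H n)}"
    by (rule closure_minimal[rotated])
  then show "c \<le> infdist x (H n)" if "x \<in> {k \<in> closure (others n). norm k = 1}" for x
    using that by auto
qed (use unit_in_others in auto)

text \<open>At each point some index \<open>m\<close> has a large product over the other indices. If
  \<open>m = n\<close>, this bounds the partial products omitting \<open>n\<close> from below;
  otherwise the factor with index \<open>n\<close> occurs in that product and is itself large. The
  bound for two spaces then depends on \<delta> alone, hence is uniform in \<open>n\<close>.\<close>

lemma separated_imp_sin_pos:
  assumes "0 < (INF z\<in>ball 0 1. SUP n. pe n z)"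
  shows "0 < (INF n. subspace_sin (H n) (closure (others n)))"
proof -
  define d where "d = (INF z\<in>ball 0 1. SUP n. pe n z)"
  have bdd: "bdd_above (range (\<lambda>n. pe n z))" if "norm z < 1" for z
    using pe_bounds(2)[OF that] by (intro bdd_aboveI[of _ 1]) auto
  have d: "d \<le> (SUP n. pe n z)" if z: "norm z < 1" for z
    unfolding d_def
  proof (rule cINF_lower)
    show "bdd_below ((\<lambda>z. SUP n. pe n z) ` ball 0 1)"
      using pe_bounds(1) bdd by (intro bdd_belowI[of _ 0]) (auto intro!: cSUP_upper2)
  qed (use z in simp)
  have "d \<le> 1"
    using d[of 0] cSUP_least[of UNIV "\<lambda>n. pe n 0" 1] pe_bounds(2)[of 0] by force
  \<comment> \<open>Halving \<open>d\<close> makes \<delta> strictly smaller than the supremum, so a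
    single index exceeds it.\<close>
  define \<delta> where "\<delta> = d / 2"
  have \<delta>: "0 < \<delta>" "\<delta> \<le> 1" using assms \<open>d \<le> 1\<close> by (simp_all add: \<delta>_def d_def)
  have sep: "\<delta> \<le> norm (bprod (Z n) z) \<or> \<delta> \<le> norm (bprod (W n N) z)" if z: "norm z < 1" for n N z
  proof -
    have "\<delta> < (SUP n. pe n z)" using d[OF z] \<delta>(1) by (simp add: \<delta>_def)
    then obtain m where m: "\<delta> < pe m z"
      using less_cSUP_iff[of UNIV "\<lambda>n. pe n z" \<delta>] bdd[OF z] by auto
    show ?thesis
    proof (cases "m = n")
      case True
      then show ?thesis using m pe_le[OF z, of n N] by simp
    next
      case False
      then show ?thesis using m pe_le[OF z, of m "Suc n"] norm_W_le[OF False z] by simp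
    qed
  qed
  define K where "K = 200 * (3 / \<delta>^4)\<^sup>2 + (1/2 :: real)"
  have K: "K > 0" by (simp add: K_def add_nonneg_pos)
  have "1 / sqrt K \<le> subspace_sin (H n) (closure (others n))" for n
  proof (rule subspace_sin_ge)
    fix x h assume x: "x \<in> others n" and h: "h \<in> H n"
    then obtain N where "x \<in> rational_space (W n N)" using others_subset by blast
    then have "(norm x)\<^sup>2 \<le> K * (norm (x - h))\<^sup>2"
      unfolding K_def using h
      by (intro rational_spaces_separated[OF \<delta> in_ball W_in_ball sep]) (auto simp: H_def)
    also have "\<dots> = (sqrt K * norm (x - h))\<^sup>2" using K by (simp add: power_mult_distrib)
    finally have "norm x \<le> sqrt K * norm (x - h)"
      by (rule power2_le_imp_le) (use K in simp)
    then show "1 / sqrt K * norm x \<le> norm (x - h)" using K by (simp add: field_simps)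
  qed
  then have "1 / sqrt K \<le> (INF n. subspace_sin (H n) (closure (others n)))"
    by (intro cINF_greatest) auto
  moreover have "1 / sqrt K > 0" using K by simp
  ultimately show ?thesis by linarith
qed

text \<open>With disjoint zero sets, a zero of the partial product has the same multiplicity there
  as in the one \<open>Z j\<close> that contains it. The pieces of the partial fraction
  decomposition therefore lie in single spaces \<open>H j\<close>.\<close>

lemma W_subset_others:
  assumes "\<And>i j. i \<noteq> j \<Longrightarrow> set_mset (Z i) \<inter> set_mset (Z j) = {}"
  shows "rational_space (W n N) \<subseteq> others n"
proof (rule rational_space_subset_subspace[OF _ W_in_ball])
  show "h2.subspace (others n)" unfolding others_def by (rule h2.subspace_span)
  fix c assume "c \<in># W n N"
  then obtain j where j: "j \<in> {..<N} - {n}" "c \<in># Z j" by (auto simp: W_def set_mset_sum)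
  have "count (W n N) c = (\<Sum>k\<in>{..<N} - {n}. count (Z k) c)" by (simp add: W_def count_sum)
  also have "\<dots> = (\<Sum>k\<in>{..<N} - {n}. if k = j then count (Z j) c else 0)"
  proof (rule sum.cong)
    fix k
    show "count (Z k) c = (if k = j then count (Z j) c else 0)"
      using assms[of k j] j(2) by (auto simp: count_eq_zero_iff)
  qed simp
  also have "\<dots> = count (Z j) c" using j(1) by simp
  finally have "replicate_mset (count (W n N) c) c \<subseteq># Z j" by (simp add: subseteq_mset_def)
  from rational_space_mono[OF this] have "rational_space (replicate_mset (count (W n N) c) c) \<subseteq> H j"
    by (simp add: H_def)
  also have "\<dots> \<subseteq> others n" using j(1) unfolding others_def by (auto intro: h2.span_base)
  finally show "rational_space (replicate_mset (count (W n N) c) c) \<subseteq> others n" .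
qed

text \<open>Where the first \<open>N\<close> moduli are all at least \<epsilon>, the reciprocal of
  their product has no poles. At a boundary point either \<open>|z| = 1\<close> and the product has
  modulus 1, or one factor has modulus \<epsilon> and the others contribute at least \<epsilon>. The
  maximum principle extends the bound inside.\<close>

lemma min_modulus:
  assumes \<epsilon>: "0 < \<epsilon>" "\<epsilon> \<le> 1"
    and sep: "\<And>n N z. norm z < 1 \<Longrightarrow> norm (bprod (Z n) z) \<le> \<epsilon> \<Longrightarrow> \<epsilon> \<le> norm (bprod (W n N) z)"
    and a: "norm a < 1" "\<And>k. \<epsilon> \<le> norm (bprod (Z k) a)"
  shows "\<epsilon>\<^sup>2 \<le> (\<Prod>k<N. norm (bprod (Z k) a))"
proof -
  \<comment> \<open>The leading \<open>cball 0 1\<close> keeps \<open>E\<close> bounded when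
    \<open>N = 0\<close> and the intersection is over no index.\<close>
  define E where "E = cball 0 1 \<inter> (\<Inter>k\<in>{..<N}. {z \<in> cball 0 1. \<epsilon> \<le> norm (bprod (Z k) z)})"
  define V where "V = (\<lambda>z. \<Prod>k<N. bprod (Z k) z)"
  have clE: "closed E"
    unfolding E_def
    by (intro closed_Int closed_cball closed_INT ballI continuous_on_closed_Collect_le continuous_intros
        continuous_bprod[OF in_ball])
  have nz: "bprod (Z k) z \<noteq> 0" if "z \<in> E" "k < N" for z k
  proof -
    have "\<epsilon> \<le> norm (bprod (Z k) z)" using that by (auto simp: E_def)
    then show ?thesis using \<epsilon>(1) by auto
  qed
  have V: "V z \<noteq> 0" if "z \<in> E" for z using nz[OF that] by (simp add: V_def)
  have "norm (inverse (V a)) \<le> inverse (\<epsilon>\<^sup>2)"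
  proof (rule maximum_modulus_frontier[where S = E and f = "\<lambda>z. inverse (V z)"])
    show "bounded E" by (rule bounded_subset[OF bounded_cball[of 0 1]]) (auto simp: E_def)
    show "a \<in> E" using a by (auto simp: E_def)
    have "interior E \<subseteq> interior (cball 0 1)" by (rule interior_mono) (auto simp: E_def)
    then have "interior E \<subseteq> ball 0 1" by (simp add: interior_cball)
    then have "V holomorphic_on interior E"
      unfolding V_def by (intro holomorphic_on_prod holomorphic_on_subset[OF holomorphic_bprod[OF in_ball]])
    then show "(\<lambda>z. inverse (V z)) holomorphic_on interior E"
      by (rule holomorphic_on_inverse) (use V interior_subset in blast)
    have "E \<subseteq> cball 0 1" by (auto simp: E_def)
    then have "continuous_on E V"
      unfolding V_def by (intro continuous_on_prod continuous_on_subset[OF continuous_bprod[OF in_ball]])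
    then show "continuous_on (closure E) (\<lambda>z. inverse (V z))"
      using V clE by (auto intro!: continuous_on_inverse)
    fix z assume z: "z \<in> frontier E"
    then have zE: "z \<in> E" using clE by (simp add: frontier_def)
    have "\<epsilon>\<^sup>2 \<le> norm (V z)"
    proof (cases "norm z = 1")
      case True
      then have "norm (V z) = 1" by (simp add: V_def prod_norm[symmetric] norm_bprod(2)[OF in_ball])
      then show ?thesis using \<epsilon> by (simp add: power_le_one)
    next
      case False
      then have zb: "norm z < 1" using zE by (auto simp: E_def)
      have "\<exists>k<N. norm (bprod (Z k) z) \<le> \<epsilon>"
      proof (rule ccontr)
        \<comment> \<open>Strict inequalities for all \<open>k < N\<close> persist near
          \<open>z\<close>, which would put \<open>z\<close> in the interior of
          \<open>E\<close>.\<close>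
        assume "\<not> ?thesis"
        then have gt: "\<epsilon> < norm (bprod (Z k) z)" if "k < N" for k using that by force
        define U where "U = ball 0 1 \<inter> (\<Inter>k\<in>{..<N}. {z \<in> ball 0 1. \<epsilon> < norm (bprod (Z k) z)})"
        have cb: "continuous_on (ball 0 1) (bprod (Z k))" for k
          by (rule continuous_on_subset[OF continuous_bprod[OF in_ball]]) auto
        have "open {z \<in> ball 0 1. \<epsilon> < norm (bprod (Z k) z)}" for k
          using continuous_open_preimage[OF continuous_on_norm[OF cb] open_ball open_greaterThan, of k \<epsilon>]
          by (simp add: vimage_def Int_def)
        then have "open U" unfolding U_def by (intro open_Int open_INT) auto
        moreover have "z \<in> U" using zb gt by (auto simp: U_def)
        moreover have "U \<subseteq> E"
        proof
          fix x assume "x \<in> U"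
          then have "norm x < 1" "\<And>k. k < N \<Longrightarrow> \<epsilon> < norm (bprod (Z k) x)" by (auto simp: U_def)
          then show "x \<in> E" by (auto simp: E_def less_imp_le)
        qed
        ultimately have "z \<in> interior E" by (auto intro: interiorI)
        then show False using z by (simp add: frontier_def)
      qed
      then obtain k where k: "k < N" "norm (bprod (Z k) z) \<le> \<epsilon>" by blast
      have "norm (V z) = norm (bprod (Z k) z) * norm (bprod (W k N) z)"
        unfolding norm_bprod_W V_def prod_norm[symmetric] using k(1) by (intro prod.remove) auto
      moreover have "\<epsilon> \<le> norm (bprod (Z k) z)" using zE k(1) by (auto simp: E_def)
      ultimately show ?thesis
        using sep[OF zb k(2), of N] \<epsilon> by (simp add: power2_eq_square mult_mono)
    qed
    then show "norm (inverse (V z)) \<le> inverse (\<epsilon>\<^sup>2)"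
      using \<epsilon>(1) by (simp add: norm_inverse le_imp_inverse_le)
  qed
  moreover have "norm (V a) > 0" using V[of a] a by (auto simp: E_def)
  ultimately have "\<epsilon>\<^sup>2 \<le> norm (V a)"
    using \<epsilon>(1) by (simp add: norm_inverse inverse_le_iff)
  then show ?thesis by (simp add: V_def prod_norm)
qed

lemma sin_pos_imp_separated:
  assumes "0 < (INF n. subspace_sin (H n) (closure (others n)))"
  shows "0 < (INF z\<in>ball 0 1. SUP n. pe n z)"
proof -
  define c where "c = (INF n. subspace_sin (H n) (closure (others n)))"
  have c0: "c > 0" using assms by (simp add: c_def)
  have "c \<le> subspace_sin (H n) (closure (others n))" for n
    unfolding c_def by (rule cINF_lower) (auto intro!: bdd_belowI[of _ 0] subspace_sin_nonneg)
  then have c: "c * norm x \<le> norm (x - h)" if "x \<in> others n" "h \<in> H n" for n x h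
    using subspace_sin_le[OF that] by (meson mult_right_mono norm_ge_zero order_trans)
  have H_others: "H j \<subseteq> others n" if "j \<noteq> n" for j n
    using that unfolding others_def by (auto intro: h2.span_base)
  \<comment> \<open>A common zero would put a unit vector into both \<open>H i\<close> and
    \<open>H j\<close>, at distance 0 from itself, against \<open>c > 0\<close>.\<close>
  have disj: "set_mset (Z i) \<inter> set_mset (Z j) = {}" if ij: "i \<noteq> j" for i j
  proof (rule ccontr)
    assume "set_mset (Z i) \<inter> set_mset (Z j) \<noteq> {}"
    then obtain v where v: "v \<in># Z i" "v \<in># Z j" by auto
    have "set_mset {#v#} \<subseteq> ball 0 1" using subsetD[OF in_ball v(1)] by simp
    from rational_space_unit_vector[OF this] obtain f where f: "f \<in> rational_space {#v#}" "norm f = 1" by auto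
    have "f \<in> H i" "f \<in> H j"
      using f(1) v rational_space_mono[of "{#v#}"] unfolding H_def by auto
    with c[of f j f] H_others[OF ij] f(2) c0 show False by auto
  qed
  obtain u where u: "u \<in> H 1" "norm u = 1"
    using rational_space_unit_vector[OF in_ball nonempty] unfolding H_def by blast
  have c1: "c \<le> 1" using c[of u 0 0] H_others[of 1 0] u zero_in_H by auto
  \<comment> \<open>If both moduli at \<open>z\<close> were at most \<epsilon>, the second strictly
    smaller, the kernel estimate would give
    \<open>c * (1 - |C(z)|) < 2 * \<epsilon> = c / 2\<close>, whereas \<open>c \<le> 1\<close> makes
    the left-hand side at least \<open>3 * c / 4\<close>.\<close>
  define \<epsilon> where "\<epsilon> = c / 4"
  have \<epsilon>: "0 < \<epsilon>" "\<epsilon> \<le> 1" using c0 c1 by (auto simp: \<epsilon>_def)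
  have sep: "\<epsilon> \<le> norm (bprod (W n N) z)" if z: "norm z < 1" and le: "norm (bprod (Z n) z) \<le> \<epsilon>" for n N z
  proof (rule ccontr)
    assume "\<not> ?thesis"
    then have lt: "norm (bprod (W n N) z) < \<epsilon>" by simp
    obtain x h k where x: "x \<in> rational_space (W n N)" "h \<in> rational_space (Z n)" "k > 0"
      "(1 - norm (bprod (W n N) z)) * k \<le> norm x"
      "norm (x - h) \<le> (norm (bprod (Z n) z) + norm (bprod (W n N) z)) * k"
      using kernel_estimate[OF z in_ball W_in_ball] by blast
    have "c * ((1 - norm (bprod (W n N) z)) * k) \<le> c * norm x" using x(4) c0 by simp
    also have "\<dots> \<le> norm (x - h)"
      using x W_subset_others[OF disj] by (intro c) (auto simp: H_def)
    finally have "(c * (1 - norm (bprod (W n N) z))) * k \<le> (norm (bprod (Z n) z) + norm (bprod (W n N) z)) * k"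
      using x(5) by (simp add: mult.assoc)
    then have "c * (1 - norm (bprod (W n N) z)) \<le> norm (bprod (Z n) z) + norm (bprod (W n N) z)"
      using x(3) by simp
    also have "\<dots> < c / 2" using le lt by (simp add: \<epsilon>_def)
    also have "\<dots> \<le> c * (1 - \<epsilon>)"
    proof -
      have "c * c \<le> c" using mult_left_le[OF c1, of c] c0 by simp
      moreover have "c * (1 - \<epsilon>) = c - c * c / 4" by (simp add: \<epsilon>_def algebra_simps)
      ultimately show ?thesis using c0 by linarith
    qed
    also have "\<dots> \<le> c * (1 - norm (bprod (W n N) z))" using lt c0 by simp
    finally show False by simp
  qed
  have "\<epsilon>\<^sup>2 \<le> (SUP n. pe n z)" if z: "norm z < 1" for z
  proof -
    have "\<exists>n. \<epsilon>\<^sup>2 \<le> pe n z"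
    proof (cases "\<exists>n. norm (bprod (Z n) z) \<le> \<epsilon>")
      case True
      then obtain n where "norm (bprod (Z n) z) \<le> \<epsilon>" by blast
      then have "\<epsilon> \<le> pe n z" by (intro pe_ge z sep)
      moreover have "\<epsilon>\<^sup>2 \<le> \<epsilon>" using \<epsilon> by (simp add: power2_eq_square mult_left_le)
      ultimately show ?thesis by (intro exI[of _ n]) simp
    next
      case False
      then have gt: "\<epsilon> \<le> norm (bprod (Z k) z)" for k by (meson less_imp_le not_le)
      \<comment> \<open>Any index would do here: omitting a factor of modulus at most 1 does not
        decrease the product.\<close>
      have "\<epsilon>\<^sup>2 \<le> norm (bprod (W 0 N) z)" for N
      proof -
        have "\<epsilon>\<^sup>2 \<le> (\<Prod>k<N. norm (bprod (Z k) z))" by (rule min_modulus[OF \<epsilon> sep z gt])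
        also have "\<dots> \<le> norm (bprod (W 0 N) z)"
          unfolding norm_bprod_W using norm_bprod(1)[OF in_ball] z
          by (cases "N = 0") (auto simp: prod.remove[of "{..<N}" 0] intro!: mult_left_le_one_le prod_nonneg)
        finally show ?thesis .
      qed
      then have "\<epsilon>\<^sup>2 \<le> pe 0 z" by (rule pe_ge[OF z])
      then show ?thesis by blast
    qed
    then obtain n where "\<epsilon>\<^sup>2 \<le> pe n z" by blast
    then show ?thesis
      using pe_bounds(2)[OF z] by (intro cSUP_upper2[where x = n]) (auto intro!: bdd_aboveI[of _ 1])
  qed
  then have "\<epsilon>\<^sup>2 \<le> (INF z\<in>ball 0 1. SUP n. pe n z)"
    by (intro cINF_greatest) auto
  moreover have "\<epsilon>\<^sup>2 > 0" using \<epsilon> by simp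
  ultimately show ?thesis by linarith
qed

end

theorem corollary5p7:
  fixes A :: "nat \<Rightarrow> complex mat" and H :: "nat \<Rightarrow> hardy2 set"
  assumes "\<And>n. square_mat (A n)"
    and "\<And>n. 0 < dim_row (A n)"
    and "\<And>n. spectrum (A n) \<subseteq> ball 0 1"
  defines "H \<equiv> \<lambda>n. model_space (blaschke_mat (A n))"
  shows "(INF z\<in>ball 0 1. SUP n. prod_except n (\<lambda>k. norm (blaschke_mat (A k) z))) > 0 \<longleftrightarrow>
         (INF n. subspace_sin (H n) (closed_span_h2 (\<Union>j\<in>- {n}. H j))) > 0"
proof -
  \<comment> \<open>Passing to multisets of zeros turns the matrices into a sequence of finite
    Blaschke products and their model spaces into rational spaces.\<close>
  have "\<forall>n. \<exists>zs. set_mset zs \<subseteq> spectrum (A n) \<and> zs \<noteq> {#} \<and> blaschke_mat (A n) = bprod zs"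
    using blaschke_mat_eq_bprod[OF assms(1,2)] by metis
  then obtain Z where Z: "\<And>n. set_mset (Z n) \<subseteq> spectrum (A n)" "\<And>n. Z n \<noteq> {#}"
    "\<And>n. blaschke_mat (A n) = bprod (Z n)" by metis
  interpret Z: blaschke_sequence Z
    using Z assms(3) by unfold_locales blast+
  have H: "H n = Z.H n" for n
    unfolding H_def Z.H_def Z(3) by (rule model_space_eq_rational_space[OF Z.in_ball])
  show ?thesis
    unfolding Z(3) H closed_span_h2_def
    using Z.separated_imp_sin_pos Z.sin_pos_imp_separated
    unfolding Z.pe_def Z.others_def by blast
qed

end
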